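(* Let $C$ be the Cesàro operator on $L^2(0,1)$, $(Cf)(x)=\frac1x\int_0^x\frac{f(t)}{1-t}\,dt$ for $0<x<1$. Then the operator norm of $C$ is $\|C\|=2$ and its spectrum is $\sigma(C)=\partial D(1,1)=\{z\in\mathbb{C}:|z-1|=1\}$.
   Context: $L^2(0,1)$ is the Hilbert space of complex-valued square-integrable functions on $(0,1)$ with respect to Lebesgue measure; $C$ is a bounded linear operator on it. $D(1,1)=\{z\in\mathbb{C}:|z-1|<1\}$. *)

theory Defs
  imports "HOL-Analysis.Analysis"
begin

section \<open>The Hilbert space of complex square-integrable functions on the unit interval\<close>

abbreviation M01 :: "real measure" where
  "M01 \<equiv> lebesgue_on {0<..<1}"

definition square_integrable :: "(real \<Rightarrow> complex) \<Rightarrow> bool" where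
  "square_integrable f \<longleftrightarrow>
     f \<in> borel_measurable M01 \<and> integrable M01 (\<lambda>x. (cmod (f x))\<^sup>2)"

lemma finite_measure_M01: "finite_measure M01"
  by (rule finite_measureI) (simp add: emeasure_restrict_space)

lemma square_integrable_measurable [measurable_dest]:
  "square_integrable f \<Longrightarrow> f \<in> borel_measurable M01"
  by (simp add: square_integrable_def)

lemma square_integrableD:
  "square_integrable f \<Longrightarrow> integrable M01 (\<lambda>x. (cmod (f x))\<^sup>2)"
  by (simp add: square_integrable_def)

lemma square_integrable_bound:
  assumes "integrable M01 h" "f \<in> borel_measurable M01"
    and "\<And>x. (cmod (f x))\<^sup>2 \<le> h x"
  shows "square_integrable f"
  unfolding square_integrable_def
proof
  show "integrable M01 (\<lambda>x. (cmod (f x))\<^sup>2)"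
    using assms(1)
  proof (rule Bochner_Integration.integrable_bound)
    show "AE x in M01. norm ((cmod (f x))\<^sup>2) \<le> norm (h x)"
      using order_trans[OF assms(3) abs_ge_self] by (intro AE_I2) simp
  qed (use assms(2) in measurable)
qed (fact assms(2))

lemma square_integrable_zero: "square_integrable (\<lambda>x. 0)"
  by (simp add: square_integrable_def)

lemma square_integrable_add:
  assumes "square_integrable f" "square_integrable g"
  shows "square_integrable (\<lambda>x. f x + g x)"
proof (rule square_integrable_bound)
  show "integrable M01 (\<lambda>x. 2 * (cmod (f x))\<^sup>2 + 2 * (cmod (g x))\<^sup>2)"
    using assms by (intro Bochner_Integration.integrable_add integrable_mult_right square_integrableD)
  show "(cmod (f x + g x))\<^sup>2 \<le> 2 * (cmod (f x))\<^sup>2 + 2 * (cmod (g x))\<^sup>2" for x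
  proof -
    have "(cmod (f x + g x))\<^sup>2 \<le> (cmod (f x) + cmod (g x))\<^sup>2"
      by (intro power_mono norm_triangle_ineq) auto
    also have "\<dots> \<le> 2 * (cmod (f x))\<^sup>2 + 2 * (cmod (g x))\<^sup>2"
      using zero_le_power2[of "cmod (f x) - cmod (g x)"]
      by (simp add: power2_eq_square algebra_simps)
    finally show ?thesis .
  qed
qed (use assms in \<open>auto intro: square_integrable_measurable\<close>)

lemma square_integrable_cmult:
  assumes "square_integrable f"
  shows "square_integrable (\<lambda>x. c * f x)"
  using assms by (auto simp: square_integrable_def norm_mult power_mult_distrib)

lemma square_integrable_uminus:
  "square_integrable f \<Longrightarrow> square_integrable (\<lambda>x. - f x)"
  using square_integrable_cmult[of f "-1"] by simp

lemma square_integrable_diff: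
  "square_integrable f \<Longrightarrow> square_integrable g \<Longrightarrow> square_integrable (\<lambda>x. f x - g x)"
  using square_integrable_add[OF _ square_integrable_uminus, of f g] by simp

lemma square_integrable_scaleR:
  "square_integrable f \<Longrightarrow> square_integrable (\<lambda>x. c *\<^sub>R f x)"
  using square_integrable_cmult[of f "of_real c"] by (simp add: scaleR_conv_of_real)

lemma square_integrable_inner:
  assumes "square_integrable f" "square_integrable g"
  shows "integrable M01 (\<lambda>x. f x \<bullet> g x)"
proof (rule Bochner_Integration.integrable_bound)
  show "integrable M01 (\<lambda>x. (cmod (f x))\<^sup>2 + (cmod (g x))\<^sup>2)"
    using assms by (intro Bochner_Integration.integrable_add square_integrableD)
  show "(\<lambda>x. f x \<bullet> g x) \<in> borel_measurable M01"
    using assms by (intro borel_measurable_inner square_integrable_measurable)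
  show "AE x in M01. norm (f x \<bullet> g x) \<le> norm ((cmod (f x))\<^sup>2 + (cmod (g x))\<^sup>2)"
  proof (rule AE_I2)
    fix x
    have "\<bar>f x \<bullet> g x\<bar> \<le> cmod (f x) * cmod (g x)"
      by (rule Cauchy_Schwarz_ineq2)
    also have "\<dots> \<le> (cmod (f x))\<^sup>2 + (cmod (g x))\<^sup>2"
    proof -
      have "2 * (cmod (f x) * cmod (g x)) \<le> (cmod (f x))\<^sup>2 + (cmod (g x))\<^sup>2"
        using sum_squares_bound[of "cmod (f x)" "cmod (g x)"] by (simp add: mult.assoc)
      moreover have "0 \<le> cmod (f x) * cmod (g x)" by simp
      ultimately show ?thesis by linarith
    qed
    finally show "norm (f x \<bullet> g x) \<le> norm ((cmod (f x))\<^sup>2 + (cmod (g x))\<^sup>2)" by simp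
  qed
qed

text \<open>Representatives are functions on the whole real line; the equivalence identifies those that
  agree almost everywhere on the unit interval, so values outside it are irrelevant.\<close>

quotient_type L2 = "real \<Rightarrow> complex" / partial:
  "\<lambda>f g. square_integrable f \<and> square_integrable g \<and> (AE x in M01. f x = g x)"
proof (rule part_equivpI)
  show "\<exists>f. square_integrable f \<and> square_integrable f \<and> (AE x in M01. f x = f x)"
    using square_integrable_zero by auto
next
  show "symp (\<lambda>f g. square_integrable f \<and> square_integrable g \<and> (AE x in M01. f x = g x))"
    by (auto simp: symp_def elim: eventually_mono)
  show "transp (\<lambda>f g. square_integrable f \<and> square_integrable g \<and> (AE x in M01. f x = g x))"
    by (auto simp: transp_def elim: eventually_elim2)
qed

text \<open>Only the real part of the complex inner product \<open>\<integral> f \<cdot> cnj g\<close> is needed for the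
  library's class of real inner product spaces; it induces the same norm.\<close>

instantiation L2 :: real_inner
begin

lift_definition zero_L2 :: L2 is "\<lambda>x. 0"
  by (simp add: square_integrable_zero)

lift_definition plus_L2 :: "L2 \<Rightarrow> L2 \<Rightarrow> L2" is "\<lambda>f g x. f x + g x"
  by (auto intro: square_integrable_add elim: eventually_elim2)

lift_definition uminus_L2 :: "L2 \<Rightarrow> L2" is "\<lambda>f x. - f x"
  by (auto intro: square_integrable_uminus elim: eventually_mono)

lift_definition minus_L2 :: "L2 \<Rightarrow> L2 \<Rightarrow> L2" is "\<lambda>f g x. f x - g x"
  by (auto intro: square_integrable_diff elim: eventually_elim2)

lift_definition scaleR_L2 :: "real \<Rightarrow> L2 \<Rightarrow> L2" is "\<lambda>c f x. c *\<^sub>R f x"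
  by (auto intro: square_integrable_scaleR elim: eventually_mono)

lift_definition inner_L2 :: "L2 \<Rightarrow> L2 \<Rightarrow> real" is "\<lambda>f g. LINT x|M01. f x \<bullet> g x"
proof -
  fix f f' g g' :: "real \<Rightarrow> complex"
  assume *: "square_integrable f \<and> square_integrable f' \<and> (AE x in M01. f x = f' x)"
    "square_integrable g \<and> square_integrable g' \<and> (AE x in M01. g x = g' x)"
  then have "AE x in M01. f x = f' x" "AE x in M01. g x = g' x" by auto
  then have "AE x in M01. f x \<bullet> g x = f' x \<bullet> g' x" by eventually_elim simp
  with * show "(LINT x|M01. f x \<bullet> g x) = (LINT x|M01. f' x \<bullet> g' x)"
    by (intro integral_cong_AE borel_measurable_inner square_integrable_measurable) auto
qed

lift_definition norm_L2 :: "L2 \<Rightarrow> real" is "\<lambda>f. sqrt (LINT x|M01. (cmod (f x))\<^sup>2)"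
proof -
  fix f f' :: "real \<Rightarrow> complex"
  assume *: "square_integrable f \<and> square_integrable f' \<and> (AE x in M01. f x = f' x)"
  then have "AE x in M01. f x = f' x" by auto
  then have "AE x in M01. (cmod (f x))\<^sup>2 = (cmod (f' x))\<^sup>2" by eventually_elim simp
  with * have "(LINT x|M01. (cmod (f x))\<^sup>2) = (LINT x|M01. (cmod (f' x))\<^sup>2)"
    by (intro integral_cong_AE)
       (auto simp: square_integrable_def)
  then show "sqrt (LINT x|M01. (cmod (f x))\<^sup>2) = sqrt (LINT x|M01. (cmod (f' x))\<^sup>2)" by simp
qed

definition dist_L2 :: "L2 \<Rightarrow> L2 \<Rightarrow> real" where
  "dist_L2 f g = norm (f - g)"

definition sgn_L2 :: "L2 \<Rightarrow> L2" where
  "sgn_L2 f = inverse (norm f) *\<^sub>R f"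

definition uniformity_L2 :: "(L2 \<times> L2) filter" where
  "uniformity_L2 = (INF e\<in>{0<..}. principal {(f, g). dist f g < e})"

definition open_L2 :: "L2 set \<Rightarrow> bool" where
  "open_L2 U \<longleftrightarrow> (\<forall>f\<in>U. eventually (\<lambda>(f', g). f' = f \<longrightarrow> g \<in> U) uniformity)"

instance
proof
  fix f g h :: L2 and a b :: real
  show "dist f g = norm (f - g)" by (rule dist_L2_def)
  show "sgn f = inverse (norm f) *\<^sub>R f" by (rule sgn_L2_def)
  show "uniformity = (INF e\<in>{0<..}. principal {(f, g :: L2). dist f g < e})"
    by (rule uniformity_L2_def)
  show "open U \<longleftrightarrow> (\<forall>f\<in>U. eventually (\<lambda>(f', g). f' = f \<longrightarrow> g \<in> U) uniformity)"
    for U :: "L2 set" by (rule open_L2_def)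
  show "f + g + h = f + (g + h)"
    by transfer (auto intro!: square_integrable_add simp: add.assoc)
  show "f + g = g + f"
    by transfer (auto intro!: square_integrable_add simp: add.commute)
  show "0 + f = f" by transfer auto
  show "- f + f = 0"
    by transfer (auto intro: square_integrable_zero)
  show "f - g = f + - g"
    by transfer (auto intro!: square_integrable_add square_integrable_diff square_integrable_uminus)
  show "a *\<^sub>R (f + g) = a *\<^sub>R f + a *\<^sub>R g"
    by transfer (auto intro!: square_integrable_add square_integrable_scaleR
        simp: scaleR_add_right)
  show "(a + b) *\<^sub>R f = a *\<^sub>R f + b *\<^sub>R f"
    by transfer (auto intro!: square_integrable_add square_integrable_scaleR
        simp: scaleR_add_left)
  show "a *\<^sub>R b *\<^sub>R f = (a * b) *\<^sub>R f"
    by transfer (auto intro!: square_integrable_scaleR)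
  show "1 *\<^sub>R f = f" by transfer auto
  show "f \<bullet> g = g \<bullet> f"
    by transfer (simp add: inner_commute)
  show "(f + g) \<bullet> h = f \<bullet> h + g \<bullet> h"
    by transfer (simp add: inner_add_left square_integrable_inner)
  show "a *\<^sub>R f \<bullet> g = a * (f \<bullet> g)"
    by transfer simp
  show "0 \<le> f \<bullet> f"
    by transfer (auto intro: Bochner_Integration.integral_nonneg)
  show "f \<bullet> f = 0 \<longleftrightarrow> f = 0"
  proof transfer
    fix f assume "square_integrable f \<and> square_integrable f \<and> (AE x in M01. f x = f x)"
    then have f: "square_integrable f" by simp
    have "(LINT x|M01. f x \<bullet> f x) = 0 \<longleftrightarrow> (AE x in M01. f x \<bullet> f x = 0)"
      using square_integrable_inner[OF f f] by (intro integral_nonneg_eq_0_iff_AE) auto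
    then show "(LINT x|M01. f x \<bullet> f x) = 0 \<longleftrightarrow>
        square_integrable f \<and> square_integrable (\<lambda>x. 0) \<and> (AE x in M01. f x = 0)"
      using f square_integrable_zero by simp
  qed
  show "norm f = sqrt (f \<bullet> f)"
    by transfer (simp add: power2_norm_eq_inner)
qed

end

lift_definition scaleC :: "complex \<Rightarrow> L2 \<Rightarrow> L2" (infixr "*\<^sub>C" 75) is "\<lambda>c f x. c * f x"
  by (auto intro: square_integrable_cmult elim: eventually_mono)

section \<open>Spectrum of a bounded operator\<close>

text \<open>The library type \<open>L2 \<Rightarrow>\<^sub>L L2\<close> consists of the bounded real-linear operators, with the
  operator norm as its norm; complex linearity is therefore a separate condition.\<close>

definition complex_linear :: "(L2 \<Rightarrow>\<^sub>L L2) \<Rightarrow> bool" where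
  "complex_linear T \<longleftrightarrow> (\<forall>c f. T (c *\<^sub>C f) = c *\<^sub>C T f)"

definition resolvent_set :: "(L2 \<Rightarrow>\<^sub>L L2) \<Rightarrow> complex set" where
  "resolvent_set T = {z. \<exists>S :: L2 \<Rightarrow>\<^sub>L L2. complex_linear S \<and>
     (\<forall>f. S (z *\<^sub>C f - T f) = f) \<and> (\<forall>f. z *\<^sub>C S f - T (S f) = f)}"

definition spectrum :: "(L2 \<Rightarrow>\<^sub>L L2) \<Rightarrow> complex set" where
  "spectrum T = - resolvent_set T"

section \<open>The Cesaro operator\<close>

definition cesaro_fun :: "(real \<Rightarrow> complex) \<Rightarrow> real \<Rightarrow> complex" where
  "cesaro_fun f x =
     1 / of_real x * (LINT t|lebesgue_on {0<..<x}. f t / of_real (1 - t))"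

text \<open>Boundedness is shown by the Schur test for the kernel of the operator, with the weight
  \<open>1 / sqrt (t (1 - t))\<close>.\<close>

definition cesaro_kernel :: "real \<Rightarrow> real \<Rightarrow> real" where
  "cesaro_kernel x t = (if t < x then 1 / (x * (1 - t)) else 0)"

definition cesaro_weight :: "real \<Rightarrow> real" where
  "cesaro_weight t = 1 / sqrt (t * (1 - t))"

lemma measurable_M01_id: "(\<lambda>x. x) \<in> borel_measurable M01"
  by (intro measurable_restrict_space1 measurable_completion) simp

lemma cesaro_weight_measurable [measurable]: "cesaro_weight \<in> borel_measurable borel" "cesaro_weight \<in> borel_measurable M01"
proof -
  show *: "cesaro_weight \<in> borel_measurable borel"
    unfolding cesaro_weight_def by measurable
  show "cesaro_weight \<in> borel_measurable M01"
    by (rule measurable_compose[OF measurable_M01_id *])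
qed

lemma cesaro_kernel_measurable [measurable]:
  "(\<lambda>(x, t). cesaro_kernel x t) \<in> borel_measurable (M01 \<Otimes>\<^sub>M M01)"
  "cesaro_kernel x \<in> borel_measurable M01"
  "(\<lambda>x. cesaro_kernel x t) \<in> borel_measurable M01"
proof -
  have [measurable]: "fst \<in> borel_measurable (M01 \<Otimes>\<^sub>M M01)" "snd \<in> borel_measurable (M01 \<Otimes>\<^sub>M M01)"
    using measurable_compose[OF measurable_fst measurable_M01_id, of M01]
      measurable_compose[OF measurable_snd measurable_M01_id, of M01] by (simp_all add: comp_def)
  show "(\<lambda>(x, t). cesaro_kernel x t) \<in> borel_measurable (M01 \<Otimes>\<^sub>M M01)"
    unfolding cesaro_kernel_def split_beta by measurable
  note measurable_M01_id [measurable]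
  show "cesaro_kernel x \<in> borel_measurable M01" "(\<lambda>x. cesaro_kernel x t) \<in> borel_measurable M01"
    unfolding cesaro_kernel_def by measurable
qed

lemma cesaro_kernel_nonneg: "x \<in> {0<..<1} \<Longrightarrow> t \<in> {0<..<1} \<Longrightarrow> 0 \<le> cesaro_kernel x t"
  by (simp add: cesaro_kernel_def)

lemma cesaro_weight_pos: "t \<in> {0<..<1} \<Longrightarrow> 0 < cesaro_weight t"
  by (simp add: cesaro_weight_def)

lemma nn_integral_M01: "(\<integral>\<^sup>+x. f x \<partial>M01) = (\<integral>\<^sup>+x. f x * indicator {0<..<1} x \<partial>lborel)"
  by (simp add: nn_integral_restrict_space nn_integral_completion)

lemma nn_integral_kernel_row:
  assumes x: "x \<in> {0<..<1}"
  shows "(\<integral>\<^sup>+t. ennreal (cesaro_kernel x t * cesaro_weight t) \<partial>M01) = ennreal (2 * cesaro_weight x)"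
proof -
  define g where "g t = (if t \<in> {0<..<x} then 1 / (1 - t) * cesaro_weight t else 0)" for t
  have "((\<lambda>t. 1 / (1 - t) * cesaro_weight t) has_integral
      (2 * sqrt (x / (1 - x)) - 2 * sqrt (0 / (1 - 0)))) {0..x}"
  proof (rule fundamental_theorem_of_calculus_interior)
    show "continuous_on {0..x} (\<lambda>t. 2 * sqrt (t / (1 - t)))"
      using x by (intro continuous_intros) auto
    fix t assume t: "t \<in> {0<..<x}"
    have s: "sqrt (t - t * t) = sqrt t * sqrt (1 - t)"
      by (simp add: real_sqrt_mult[symmetric] algebra_simps)
    have "((\<lambda>t. 2 * sqrt (t / (1 - t))) has_real_derivative 1 / (1 - t) * cesaro_weight t) (at t)"
      unfolding cesaro_weight_def using x t
      by (auto intro!: derivative_eq_intros simp: s field_simps real_sqrt_divide real_sqrt_mult)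
    then show "((\<lambda>t. 2 * sqrt (t / (1 - t))) has_vector_derivative 1 / (1 - t) * cesaro_weight t) (at t)"
      by (simp add: has_real_derivative_iff_has_vector_derivative)
  qed (use x in simp)
  then have "((\<lambda>t. 1 / (1 - t) * cesaro_weight t) has_integral (2 * sqrt (x / (1 - x)))) {0<..<x}"
    by (simp add: has_integral_Icc_iff_Ioo)
  then have "(g has_integral (2 * sqrt (x / (1 - x)))) {0<..<x}"
    by (rule has_integral_eq_rhs[OF has_integral_eq[rotated]]) (auto simp: g_def)
  moreover have "0 \<le> g t" for t
    using x by (auto simp: g_def cesaro_weight_def)
  ultimately have "(\<integral>\<^sup>+t. ennreal (indicator {0<..<x} t * g t) \<partial>lborel) = ennreal (2 * sqrt (x / (1 - x)))"
    by (intro nn_integral_has_integral_lebesgue) auto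
  then have "ennreal (1 / x) * (\<integral>\<^sup>+t. ennreal (indicator {0<..<x} t * g t) \<partial>lborel) =
      ennreal (2 * cesaro_weight x)"
    using x by (simp add: ennreal_mult'[symmetric] cesaro_weight_def real_sqrt_divide
        real_sqrt_mult real_div_sqrt divide_simps)
  moreover have [measurable]: "g \<in> borel_measurable lborel"
    unfolding g_def by measurable
  have "(\<integral>\<^sup>+t. ennreal (cesaro_kernel x t * cesaro_weight t) \<partial>M01) =
      (\<integral>\<^sup>+t. ennreal (1 / x) * ennreal (indicator {0<..<x} t * g t) \<partial>lborel)"
    unfolding nn_integral_M01 using x
    by (intro nn_integral_cong)
       (auto simp: cesaro_kernel_def g_def indicator_def ennreal_mult'[symmetric] mult.commute)
  ultimately show ?thesis
    by (simp add: nn_integral_cmult)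
qed

lemma nn_integral_kernel_column:
  assumes t: "t \<in> {0<..<1}"
  shows "(\<integral>\<^sup>+x. ennreal (cesaro_kernel x t * cesaro_weight x) \<partial>M01) = ennreal (2 * cesaro_weight t)"
proof -
  define g where "g x = (if x \<in> {t<..<1} then 1 / x * cesaro_weight x else 0)" for x
  have "((\<lambda>x. 1 / x * cesaro_weight x) has_integral
      (- 2 * sqrt ((1 - 1) / 1) - (- 2 * sqrt ((1 - t) / t)))) {t..1}"
  proof (rule fundamental_theorem_of_calculus_interior)
    show "continuous_on {t..1} (\<lambda>x. - 2 * sqrt ((1 - x) / x))"
      using t by (intro continuous_intros) auto
    fix x assume x: "x \<in> {t<..<1}"
    have s: "sqrt (x - x * x) = sqrt x * sqrt (1 - x)"
      by (simp add: real_sqrt_mult[symmetric] algebra_simps)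
    have "((\<lambda>x. - 2 * sqrt ((1 - x) / x)) has_real_derivative 1 / x * cesaro_weight x) (at x)"
      unfolding cesaro_weight_def using x t
      by (auto intro!: derivative_eq_intros simp: s field_simps real_sqrt_divide real_sqrt_mult)
    then show "((\<lambda>x. - 2 * sqrt ((1 - x) / x)) has_vector_derivative 1 / x * cesaro_weight x) (at x)"
      by (simp add: has_real_derivative_iff_has_vector_derivative)
  qed (use t in simp)
  then have "((\<lambda>x. 1 / x * cesaro_weight x) has_integral (2 * sqrt ((1 - t) / t))) {t<..<1}"
    by (simp add: has_integral_Icc_iff_Ioo)
  then have "(g has_integral (2 * sqrt ((1 - t) / t))) {t<..<1}"
    by (rule has_integral_eq_rhs[OF has_integral_eq[rotated]]) (auto simp: g_def)
  moreover have "0 \<le> g x" for x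
    using t by (auto simp: g_def cesaro_weight_def)
  ultimately have "(\<integral>\<^sup>+x. ennreal (indicator {t<..<1} x * g x) \<partial>lborel) = ennreal (2 * sqrt ((1 - t) / t))"
    by (intro nn_integral_has_integral_lebesgue) auto
  then have "ennreal (1 / (1 - t)) * (\<integral>\<^sup>+x. ennreal (indicator {t<..<1} x * g x) \<partial>lborel) =
      ennreal (2 * cesaro_weight t)"
    using t by (simp add: ennreal_mult'[symmetric] cesaro_weight_def real_sqrt_divide
        real_sqrt_mult real_div_sqrt divide_simps)
  moreover have [measurable]: "g \<in> borel_measurable lborel"
    unfolding g_def by measurable
  have "(\<integral>\<^sup>+x. ennreal (cesaro_kernel x t * cesaro_weight x) \<partial>M01) =
      (\<integral>\<^sup>+x. ennreal (1 / (1 - t)) * ennreal (indicator {t<..<1} x * g x) \<partial>lborel)"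
    unfolding nn_integral_M01 using t
    by (intro nn_integral_cong)
       (auto simp: cesaro_kernel_def g_def indicator_def ennreal_mult'[symmetric] mult.commute)
  ultimately show ?thesis
    by (simp add: nn_integral_cmult)
qed

lemma cesaro_schur_pointwise:
  assumes f: "square_integrable f" and x: "x \<in> {0<..<1}"
  shows "(\<integral>\<^sup>+t. ennreal (cesaro_kernel x t * cmod (f t)) \<partial>M01)\<^sup>2 \<le>
    (\<integral>\<^sup>+t. ennreal (2 * cesaro_weight x * cesaro_kernel x t * (cmod (f t))\<^sup>2 / cesaro_weight t) \<partial>M01)"
proof -
  have [measurable]: "f \<in> borel_measurable M01" using f by (rule square_integrable_measurable)
  let ?a = "\<lambda>t. sqrt (cesaro_kernel x t * cesaro_weight t)"
  let ?b = "\<lambda>t. sqrt (cesaro_kernel x t / cesaro_weight t) * cmod (f t)"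
  have "(\<integral>\<^sup>+t. ennreal (cesaro_kernel x t * cmod (f t)) \<partial>M01)\<^sup>2 =
      (\<integral>\<^sup>+t. ennreal (?a t) * ennreal (?b t) \<partial>M01)\<^sup>2"
  proof (intro arg_cong[where f = "\<lambda>y. y\<^sup>2"] nn_integral_cong)
    fix t assume "t \<in> space M01"
    then have t: "t \<in> {0<..<1}" by simp
    note p = cesaro_kernel_nonneg[OF x t] cesaro_weight_pos[OF t]
    have "?a t * ?b t = cesaro_kernel x t * cmod (f t)"
      using p by (simp add: real_sqrt_mult real_sqrt_divide)
    then show "ennreal (cesaro_kernel x t * cmod (f t)) = ennreal (?a t) * ennreal (?b t)"
      using p by (subst ennreal_mult[symmetric]) auto
  qed
  also have "\<dots> \<le> (\<integral>\<^sup>+t. (ennreal (?a t))\<^sup>2 \<partial>M01) * (\<integral>\<^sup>+t. (ennreal (?b t))\<^sup>2 \<partial>M01)"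
    by (rule Cauchy_Schwarz_nn_integral) measurable
  also have "(\<integral>\<^sup>+t. (ennreal (?a t))\<^sup>2 \<partial>M01) =
      (\<integral>\<^sup>+t. ennreal (cesaro_kernel x t * cesaro_weight t) \<partial>M01)"
  proof (rule nn_integral_cong)
    fix t assume "t \<in> space M01"
    then have t: "t \<in> {0<..<1}" by simp
    show "(ennreal (?a t))\<^sup>2 = ennreal (cesaro_kernel x t * cesaro_weight t)"
      using cesaro_kernel_nonneg[OF x t] cesaro_weight_pos[OF t]
      by (simp add: ennreal_power)
  qed
  also have "\<dots> = ennreal (2 * cesaro_weight x)"
    by (rule nn_integral_kernel_row[OF x])
  also have "ennreal (2 * cesaro_weight x) * (\<integral>\<^sup>+t. (ennreal (?b t))\<^sup>2 \<partial>M01) =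
      (\<integral>\<^sup>+t. ennreal (2 * cesaro_weight x) * (ennreal (?b t))\<^sup>2 \<partial>M01)"
    by (rule nn_integral_cmult[symmetric]) measurable
  also have "\<dots> = (\<integral>\<^sup>+t. ennreal (2 * cesaro_weight x * cesaro_kernel x t * (cmod (f t))\<^sup>2 / cesaro_weight t) \<partial>M01)"
  proof (rule nn_integral_cong)
    fix t assume "t \<in> space M01"
    then have t: "t \<in> {0<..<1}" by simp
    show "ennreal (2 * cesaro_weight x) * (ennreal (?b t))\<^sup>2 =
        ennreal (2 * cesaro_weight x * cesaro_kernel x t * (cmod (f t))\<^sup>2 / cesaro_weight t)"
      using cesaro_kernel_nonneg[OF x t] cesaro_weight_pos[OF t] cesaro_weight_pos[OF x]
      by (simp add: ennreal_power ennreal_mult[symmetric] power_mult_distrib)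
  qed
  finally show ?thesis .
qed

lemma cesaro_schur:
  assumes f: "square_integrable f"
  shows "(\<integral>\<^sup>+x. (\<integral>\<^sup>+t. ennreal (cesaro_kernel x t * cmod (f t)) \<partial>M01)\<^sup>2 \<partial>M01) \<le>
    4 * (\<integral>\<^sup>+t. ennreal ((cmod (f t))\<^sup>2) \<partial>M01)"
proof -
  interpret finite_measure M01 by (rule finite_measure_M01)
  interpret pair_sigma_finite M01 M01 ..
  have [measurable]: "f \<in> borel_measurable M01" using f by (rule square_integrable_measurable)
  have "(\<integral>\<^sup>+x. (\<integral>\<^sup>+t. ennreal (cesaro_kernel x t * cmod (f t)) \<partial>M01)\<^sup>2 \<partial>M01) \<le>
      (\<integral>\<^sup>+x. (\<integral>\<^sup>+t. ennreal (2 * cesaro_weight x * cesaro_kernel x t * (cmod (f t))\<^sup>2 / cesaro_weight t) \<partial>M01) \<partial>M01)"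
    by (intro nn_integral_mono cesaro_schur_pointwise f) simp
  also have "\<dots> =
      (\<integral>\<^sup>+t. (\<integral>\<^sup>+x. ennreal (2 * cesaro_weight x * cesaro_kernel x t * (cmod (f t))\<^sup>2 / cesaro_weight t) \<partial>M01) \<partial>M01)"
    by (rule Fubini'[symmetric]) measurable
  also have "\<dots> = (\<integral>\<^sup>+t. 4 * ennreal ((cmod (f t))\<^sup>2) \<partial>M01)"
  proof (rule nn_integral_cong)
    fix t assume "t \<in> space M01"
    then have t: "t \<in> {0<..<1}" by simp
    have "(\<integral>\<^sup>+x. ennreal (2 * cesaro_weight x * cesaro_kernel x t * (cmod (f t))\<^sup>2 / cesaro_weight t) \<partial>M01) =
        (\<integral>\<^sup>+x. ennreal (2 * (cmod (f t))\<^sup>2 / cesaro_weight t) *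
          ennreal (cesaro_kernel x t * cesaro_weight x) \<partial>M01)"
      using cesaro_weight_pos[OF t]
      by (intro nn_integral_cong, subst ennreal_mult'[symmetric]) (simp_all add: mult_ac)
    also have "\<dots> = ennreal (2 * (cmod (f t))\<^sup>2 / cesaro_weight t) * ennreal (2 * cesaro_weight t)"
      by (subst nn_integral_cmult) (simp_all add: nn_integral_kernel_column[OF t])
    also have "\<dots> = ennreal (4 * (cmod (f t))\<^sup>2)"
      using cesaro_weight_pos[OF t] by (simp add: ennreal_mult'[symmetric])
    finally show "(\<integral>\<^sup>+x. ennreal (2 * cesaro_weight x * cesaro_kernel x t * (cmod (f t))\<^sup>2 / cesaro_weight t) \<partial>M01) =
        4 * ennreal ((cmod (f t))\<^sup>2)"
      by (simp add: ennreal_mult)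
  qed
  also have "\<dots> = 4 * (\<integral>\<^sup>+t. ennreal ((cmod (f t))\<^sup>2) \<partial>M01)"
    by (rule nn_integral_cmult) measurable
  finally show ?thesis .
qed

lemma cesaro_fun_kernel:
  assumes x: "x \<in> {0<..<1}"
  shows "cesaro_fun f x = (LINT t|M01. of_real (cesaro_kernel x t) * f t)"
proof -
  have "(LINT t|M01. of_real (cesaro_kernel x t) * f t) =
      (LINT t|M01. 1 / of_real x * (if t \<in> {0<..<x} then f t / of_real (1 - t) else 0))"
    by (rule Bochner_Integration.integral_cong) (auto simp: cesaro_kernel_def)
  also have "\<dots> = 1 / of_real x *
      (LINT t|M01. (if t \<in> {0<..<x} then f t / of_real (1 - t) else 0))"
    by (rule integral_mult_right_zero)
  also have "(LINT t|M01. (if t \<in> {0<..<x} then f t / of_real (1 - t) else 0)) =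
      (LINT t|lebesgue_on {0<..<x}. f t / of_real (1 - t))"
    using x by (intro integral_restrict) auto
  finally show ?thesis
    by (simp add: cesaro_fun_def)
qed

lemma square_integrable_imp_integrable_M01:
  assumes f: "square_integrable f"
  shows "integrable M01 f"
proof -
  interpret finite_measure M01 by (rule finite_measure_M01)
  have [measurable]: "f \<in> borel_measurable M01" using f by (rule square_integrable_measurable)
  have "integrable M01 (\<lambda>x. (f x)\<^sup>2)"
    using square_integrableD[OF f]
    by (rule Bochner_Integration.integrable_bound) (auto simp: norm_power)
  with \<open>f \<in> borel_measurable M01\<close> show ?thesis
    by (rule square_integrable_imp_integrable)
qed

lemma integrable_cesaro_kernel:
  assumes f: "square_integrable f" and x: "x \<in> {0<..<1}"
  shows "integrable M01 (\<lambda>t. of_real (cesaro_kernel x t) * f t)"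
proof (rule Bochner_Integration.integrable_bound)
  show "integrable M01 (\<lambda>t. of_real (1 / (x * (1 - x))) * f t)"
    by (intro integrable_mult_right square_integrable_imp_integrable_M01 f)
  have [measurable]: "f \<in> borel_measurable M01" using f by (rule square_integrable_measurable)
  show "(\<lambda>t. of_real (cesaro_kernel x t) * f t) \<in> borel_measurable M01"
    by measurable
  show "AE t in M01. norm (of_real (cesaro_kernel x t) * f t) \<le> norm (of_real (1 / (x * (1 - x))) * f t)"
  proof (rule AE_I2)
    fix t assume "t \<in> space M01"
    then have t: "t \<in> {0<..<1}" by simp
    have "\<bar>cesaro_kernel x t\<bar> \<le> \<bar>1 / (x * (1 - x))\<bar>"
      using x t by (auto simp: cesaro_kernel_def intro!: divide_left_mono)
    then show "norm (of_real (cesaro_kernel x t) * f t) \<le> norm (of_real (1 / (x * (1 - x))) * f t)"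
      unfolding norm_mult norm_of_real by (rule mult_right_mono) simp
  qed
qed

lemma cesaro_fun_measurable:
  assumes f: "square_integrable f"
  shows "cesaro_fun f \<in> borel_measurable M01"
proof -
  interpret finite_measure M01 by (rule finite_measure_M01)
  have [measurable]: "f \<in> borel_measurable M01" using f by (rule square_integrable_measurable)
  have "(\<lambda>x. LINT t|M01. of_real (cesaro_kernel x t) * f t) \<in> borel_measurable M01"
    by measurable
  then show ?thesis
    by (rule measurable_cong[THEN iffD2, rotated]) (simp add: cesaro_fun_kernel)
qed

lemma cesaro_fun_nn_bound:
  assumes f: "square_integrable f"
  shows "(\<integral>\<^sup>+x. ennreal ((cmod (cesaro_fun f x))\<^sup>2) \<partial>M01) \<le>
    ennreal (4 * (LINT x|M01. (cmod (f x))\<^sup>2))"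
proof -
  have "(\<integral>\<^sup>+x. ennreal ((cmod (cesaro_fun f x))\<^sup>2) \<partial>M01) \<le>
      (\<integral>\<^sup>+x. (\<integral>\<^sup>+t. ennreal (cesaro_kernel x t * cmod (f t)) \<partial>M01)\<^sup>2 \<partial>M01)"
  proof (rule nn_integral_mono)
    fix x assume "x \<in> space M01"
    then have x: "x \<in> {0<..<1}" by simp
    have "ennreal (cmod (cesaro_fun f x)) \<le>
        (\<integral>\<^sup>+t. ennreal (cmod (of_real (cesaro_kernel x t) * f t)) \<partial>M01)"
      unfolding cesaro_fun_kernel[OF x]
      by (rule integral_norm_bound_ennreal[OF integrable_cesaro_kernel[OF f x]])
    also have "\<dots> = (\<integral>\<^sup>+t. ennreal (cesaro_kernel x t * cmod (f t)) \<partial>M01)"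
      using cesaro_kernel_nonneg[OF x] by (intro nn_integral_cong) (simp add: norm_mult)
    finally have "(ennreal (cmod (cesaro_fun f x)))\<^sup>2 \<le> (\<integral>\<^sup>+t. ennreal (cesaro_kernel x t * cmod (f t)) \<partial>M01)\<^sup>2"
      by (intro power_mono) auto
    then show "ennreal ((cmod (cesaro_fun f x))\<^sup>2) \<le>
        (\<integral>\<^sup>+t. ennreal (cesaro_kernel x t * cmod (f t)) \<partial>M01)\<^sup>2"
      by (simp add: ennreal_power)
  qed
  also have "\<dots> \<le> 4 * (\<integral>\<^sup>+t. ennreal ((cmod (f t))\<^sup>2) \<partial>M01)"
    by (rule cesaro_schur[OF f])
  also have "\<dots> = ennreal (4 * (LINT x|M01. (cmod (f x))\<^sup>2))"
    using square_integrableD[OF f]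
    by (subst nn_integral_eq_integral) (auto simp: ennreal_mult)
  finally show ?thesis .
qed

lemma square_integrable_cesaro_fun:
  assumes f: "square_integrable f"
  shows "square_integrable (cesaro_fun f)"
proof -
  have [measurable]: "cesaro_fun f \<in> borel_measurable M01" by (rule cesaro_fun_measurable[OF f])
  have "integrable M01 (\<lambda>x. (cmod (cesaro_fun f x))\<^sup>2)"
    using le_less_trans[OF cesaro_fun_nn_bound[OF f] ennreal_less_top]
    by (intro integrableI_bounded) simp_all
  then show ?thesis
    by (simp add: square_integrable_def)
qed

lemma cesaro_fun_norm_bound:
  assumes f: "square_integrable f"
  shows "(LINT x|M01. (cmod (cesaro_fun f x))\<^sup>2) \<le> 4 * (LINT x|M01. (cmod (f x))\<^sup>2)"
proof -
  have "ennreal (LINT x|M01. (cmod (cesaro_fun f x))\<^sup>2) \<le> ennreal (4 * (LINT x|M01. (cmod (f x))\<^sup>2))"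
    using cesaro_fun_nn_bound[OF f] square_integrableD[OF square_integrable_cesaro_fun[OF f]]
    by (subst (asm) nn_integral_eq_integral) auto
  then show ?thesis
    by (subst (asm) ennreal_le_iff) auto
qed

lift_definition cesaro_map :: "L2 \<Rightarrow> L2" is cesaro_fun
proof (intro conjI)
  fix f g assume *: "square_integrable f \<and> square_integrable g \<and> (AE x in M01. f x = g x)"
  then show "square_integrable (cesaro_fun f)" "square_integrable (cesaro_fun g)"
    by (auto intro: square_integrable_cesaro_fun)
  have [measurable]: "f \<in> borel_measurable M01" "g \<in> borel_measurable M01"
    using * by (auto intro: square_integrable_measurable)
  show "AE x in M01. cesaro_fun f x = cesaro_fun g x"
  proof (rule AE_I2)
    fix x assume "x \<in> space M01"
    then have x: "x \<in> {0<..<1}" by simp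
    from * have "AE t in M01. f t = g t" by simp
    then have "AE t in M01. of_real (cesaro_kernel x t) * f t = of_real (cesaro_kernel x t) * g t"
      by eventually_elim simp
    then show "cesaro_fun f x = cesaro_fun g x"
      unfolding cesaro_fun_kernel[OF x] by (intro integral_cong_AE) auto
  qed
qed

lift_definition cesaro :: "L2 \<Rightarrow>\<^sub>L L2" is cesaro_map
proof (rule bounded_linear_intro)
  fix f g :: L2 and c :: real
  show "cesaro_map (f + g) = cesaro_map f + cesaro_map g"
  proof transfer
    fix f g
    assume "square_integrable f \<and> square_integrable f \<and> (AE x in M01. f x = f x)"
      and "square_integrable g \<and> square_integrable g \<and> (AE x in M01. g x = g x)"
    then have f: "square_integrable f" and g: "square_integrable g" by auto
    have "cesaro_fun (\<lambda>x. f x + g x) x = cesaro_fun f x + cesaro_fun g x" if x: "x \<in> {0<..<1}" for x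
      using integrable_cesaro_kernel[OF f x] integrable_cesaro_kernel[OF g x]
      by (simp add: cesaro_fun_kernel[OF x] distrib_left)
    then show "square_integrable (cesaro_fun (\<lambda>x. f x + g x)) \<and>
        square_integrable (\<lambda>x. cesaro_fun f x + cesaro_fun g x) \<and>
        (AE x in M01. cesaro_fun (\<lambda>x. f x + g x) x = cesaro_fun f x + cesaro_fun g x)"
      using f g by (auto intro!: square_integrable_cesaro_fun square_integrable_add AE_I2)
  qed
  show "cesaro_map (c *\<^sub>R f) = c *\<^sub>R cesaro_map f"
  proof transfer
    fix c :: real and f
    assume "square_integrable f \<and> square_integrable f \<and> (AE x in M01. f x = f x)"
    then have f: "square_integrable f" by auto
    have "cesaro_fun (\<lambda>x. c *\<^sub>R f x) x = c *\<^sub>R cesaro_fun f x" if x: "x \<in> {0<..<1}" for x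
      by (simp add: cesaro_fun_kernel[OF x])
    then show "square_integrable (cesaro_fun (\<lambda>x. c *\<^sub>R f x)) \<and>
        square_integrable (\<lambda>x. c *\<^sub>R cesaro_fun f x) \<and>
        (AE x in M01. cesaro_fun (\<lambda>x. c *\<^sub>R f x) x = c *\<^sub>R cesaro_fun f x)"
      using f by (auto intro!: square_integrable_cesaro_fun square_integrable_scaleR AE_I2)
  qed
  show "norm (cesaro_map f) \<le> norm f * 2"
  proof transfer
    fix f assume "square_integrable f \<and> square_integrable f \<and> (AE x in M01. f x = f x)"
    then have "sqrt (LINT x|M01. (cmod (cesaro_fun f x))\<^sup>2) \<le> sqrt (4 * (LINT x|M01. (cmod (f x))\<^sup>2))"
      by (intro real_sqrt_le_mono cesaro_fun_norm_bound) simp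
    then show "sqrt (LINT x|M01. (cmod (cesaro_fun f x))\<^sup>2) \<le> sqrt (LINT x|M01. (cmod (f x))\<^sup>2) * 2"
      by (simp add: real_sqrt_mult)
  qed
qed

lemma cesaro_abs_L2:
  "square_integrable f \<Longrightarrow> cesaro (abs_L2 f) = abs_L2 (cesaro_fun f)"
  by (simp add: cesaro.rep_eq cesaro_map.abs_eq)

lemma complex_linear_cesaro: "complex_linear cesaro"
  unfolding complex_linear_def
proof (intro allI)
  fix c f
  have "cesaro_map (c *\<^sub>C f) = c *\<^sub>C cesaro_map f"
  proof transfer
    fix c :: complex and f
    assume "square_integrable f \<and> square_integrable f \<and> (AE x in M01. f x = f x)"
    then have f: "square_integrable f" by auto
    have "cesaro_fun (\<lambda>x. c * f x) x = c * cesaro_fun f x" if x: "x \<in> {0<..<1}" for x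
      by (simp add: cesaro_fun_kernel[OF x] mult.left_commute[of _ c])
    then show "square_integrable (cesaro_fun (\<lambda>x. c * f x)) \<and>
        square_integrable (\<lambda>x. c * cesaro_fun f x) \<and>
        (AE x in M01. cesaro_fun (\<lambda>x. c * f x) x = c * cesaro_fun f x)"
      using f by (auto intro!: square_integrable_cesaro_fun square_integrable_cmult AE_I2)
  qed
  then show "cesaro (c *\<^sub>C f) = c *\<^sub>C cesaro f"
    by (simp add: cesaro.rep_eq)
qed

end

theory Submission
  imports Defs
begin

text \<open>
Substitute \<open>s = x / (1 - x)\<close> and put \<open>g s = f x / (1 + s)\<close>. This identifies \<open>L\<^sup>2(0,1)\<close> with
\<open>L\<^sup>2(0,\<infinity>)\<close> and turns \<open>C\<close> into the averaging operator \<open>g \<mapsto> (1 / s) \<integral>\<^sub>0\<^sup>s g\<close>, which commutes with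
dilations and maps the power \<open>s powr (p - 1)\<close> to \<open>1 / p\<close> times itself. Such a power lies on the border
of square integrability exactly when \<open>Re p = 1 / 2\<close>, that is, when \<open>z = 1 / p\<close> satisfies
\<open>|z - 1| = 1\<close>. The proof makes both directions of this heuristic precise, working on \<open>(0,1)\<close>
throughout with the powers written as \<open>exp (c * logit x)\<close>.

\<^item> Off the circle, put \<open>a = 1 / z\<close>. Solving \<open>z h - C h = f\<close>, a first-order linear differential
  equation for the primitive of \<open>h t / (1 - t)\<close>, gives \<open>h = a f + a\<^sup>2 K f\<close>. Here \<open>K\<close> is the
  integral operator with kernel
  \<open>exp (a (logit x - logit t)) / (x (1 - t))\<close> on \<open>t < x\<close> if \<open>Re a < 1 / 2\<close>, and with the negative of
  this kernel on \<open>x \<le> t\<close> if \<open>Re a > 1 / 2\<close>. The Schur test bounds \<open>K\<close> (\<open>schur_kernel_lower\<close>,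
  \<open>schur_kernel_upper\<close>). The kernels compose by an exact resolvent identity (\<open>lower_lower_compose\<close>,
  \<open>lower_upper_compose\<close>, \<open>upper_lower_compose\<close>), so the formula does give a two-sided inverse
  (\<open>resolvent_set_cesaro\<close>).

\<^item> For \<open>w\<close> inside the disc, the power with exponent \<open>p = 1 / w\<close>, cut off at \<open>x = 1 / 2\<close>, is a square
  integrable \<open>f\<close> with \<open>\<parallel>w f - C f\<parallel> = sqrt (1 - |w - 1|\<^sup>2) \<parallel>f\<parallel>\<close> (\<open>approximate_eigenvector\<close>). Letting
  \<open>w\<close> tend to a boundary point \<open>z\<close> shows that \<open>z - C\<close> is not bounded below, hence that \<open>z\<close> belongs to
  the spectrum.

The norm is at most \<open>2\<close> by the Schur test and at least \<open>2\<close> because \<open>z = 2\<close> is an approximate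
eigenvalue.
\<close>

section \<open>Integral operators whose kernel passes the Schur test\<close>

text \<open>The weight of the Schur test is fixed to \<open>1 / sqrt (x (1 - x))\<close>. It suits every kernel used
below: transported to the half-line by \<open>s = x / (1 - x)\<close>, each of them is homogeneous of degree
\<open>-1\<close>, and the weight becomes \<open>s powr (- 1 / 2)\<close>, the power on the border of square integrability.\<close>

definition schur_kernel :: "real \<Rightarrow> (real \<Rightarrow> real \<Rightarrow> complex) \<Rightarrow> bool" where
  "schur_kernel B k \<longleftrightarrow> 0 \<le> B \<and> (\<lambda>(x, t). k x t) \<in> borel_measurable (M01 \<Otimes>\<^sub>M M01) \<and>
     (\<forall>x\<in>{0<..<1}. (\<integral>\<^sup>+t. ennreal (cmod (k x t) * cesaro_weight t) \<partial>M01) \<le> ennreal (B * cesaro_weight x)) \<and>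
     (\<forall>t\<in>{0<..<1}. (\<integral>\<^sup>+x. ennreal (cmod (k x t) * cesaro_weight x) \<partial>M01) \<le> ennreal (B * cesaro_weight t))"

definition kernel_fun :: "(real \<Rightarrow> real \<Rightarrow> complex) \<Rightarrow> (real \<Rightarrow> complex) \<Rightarrow> real \<Rightarrow> complex" where
  "kernel_fun k f x = (LINT t|M01. k x t * f t)"

lemma schur_kernel_nonneg: "schur_kernel B k \<Longrightarrow> 0 \<le> B"
  by (simp add: schur_kernel_def)

lemma schur_kernel_measurable:
  assumes "schur_kernel B k"
  shows "(\<lambda>(x, t). k x t) \<in> borel_measurable (M01 \<Otimes>\<^sub>M M01)"
  using assms by (simp add: schur_kernel_def)

lemma schur_kernel_measurable_row:
  assumes "schur_kernel B k" "x \<in> {0<..<1}"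
  shows "k x \<in> borel_measurable M01"
  using measurable_Pair2[OF schur_kernel_measurable[OF assms(1)], of x] assms(2) by simp

lemma schur_row:
  assumes "schur_kernel B k" "x \<in> {0<..<1}"
  shows "(\<integral>\<^sup>+t. ennreal (cmod (k x t) * cesaro_weight t) \<partial>M01) \<le> ennreal (B * cesaro_weight x)"
  using assms by (simp add: schur_kernel_def)

lemma schur_column:
  assumes "schur_kernel B k" "t \<in> {0<..<1}"
  shows "(\<integral>\<^sup>+x. ennreal (cmod (k x t) * cesaro_weight x) \<partial>M01) \<le> ennreal (B * cesaro_weight t)"
  using assms by (simp add: schur_kernel_def)

text \<open>Cauchy--Schwarz applied to the factors \<open>sqrt (|k| w)\<close> and \<open>sqrt (|k| / w) g\<close>, whose product is
\<open>|k| g\<close>; the row bound controls the first one. Stating it for \<open>g\<close> with values in \<^typ>\<open>ennreal\<close>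
lets \<open>g\<close> itself be an integral of absolute values, which is what composing two operators needs.\<close>

lemma schur_pointwise:
  fixes g :: "real \<Rightarrow> ennreal"
  assumes k: "schur_kernel B k" and g [measurable]: "g \<in> borel_measurable M01"
    and x: "x \<in> {0<..<1}"
  shows "(\<integral>\<^sup>+t. ennreal (cmod (k x t)) * g t \<partial>M01)\<^sup>2 \<le>
    (\<integral>\<^sup>+t. ennreal (B * cesaro_weight x * cmod (k x t) / cesaro_weight t) * (g t)\<^sup>2 \<partial>M01)"
proof -
  have [measurable]: "k x \<in> borel_measurable M01" by (rule schur_kernel_measurable_row[OF k x])
  let ?u = "\<lambda>t. ennreal (sqrt (cmod (k x t) * cesaro_weight t))"
  let ?v = "\<lambda>t. ennreal (sqrt (cmod (k x t) / cesaro_weight t)) * g t"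
  have "(\<integral>\<^sup>+t. ennreal (cmod (k x t)) * g t \<partial>M01)\<^sup>2 = (\<integral>\<^sup>+t. ?u t * ?v t \<partial>M01)\<^sup>2"
  proof (intro arg_cong[where f = "\<lambda>y. y\<^sup>2"] nn_integral_cong)
    fix t assume "t \<in> space M01"
    then have p: "0 < cesaro_weight t" by (simp add: cesaro_weight_pos)
    have "sqrt (cmod (k x t) * cesaro_weight t) * sqrt (cmod (k x t) / cesaro_weight t) = cmod (k x t)"
      using p by (simp add: real_sqrt_mult real_sqrt_divide)
    then have "ennreal (cmod (k x t)) = ?u t * ennreal (sqrt (cmod (k x t) / cesaro_weight t))"
      using p by (subst ennreal_mult[symmetric]) auto
    then show "ennreal (cmod (k x t)) * g t = ?u t * ?v t"
      by (simp add: mult.assoc)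
  qed
  also have "\<dots> \<le> (\<integral>\<^sup>+t. (?u t)\<^sup>2 \<partial>M01) * (\<integral>\<^sup>+t. (?v t)\<^sup>2 \<partial>M01)"
    by (rule Cauchy_Schwarz_nn_integral) measurable
  also have "(\<integral>\<^sup>+t. (?u t)\<^sup>2 \<partial>M01) = (\<integral>\<^sup>+t. ennreal (cmod (k x t) * cesaro_weight t) \<partial>M01)"
  proof (rule nn_integral_cong)
    fix t assume "t \<in> space M01"
    then have "0 < cesaro_weight t" by (simp add: cesaro_weight_pos)
    then show "(?u t)\<^sup>2 = ennreal (cmod (k x t) * cesaro_weight t)"
      by (simp add: ennreal_power)
  qed
  also have "\<dots> * (\<integral>\<^sup>+t. (?v t)\<^sup>2 \<partial>M01) \<le> ennreal (B * cesaro_weight x) * (\<integral>\<^sup>+t. (?v t)\<^sup>2 \<partial>M01)"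
    by (intro mult_right_mono schur_row[OF k x]) simp
  also have "\<dots> = (\<integral>\<^sup>+t. ennreal (B * cesaro_weight x) * (?v t)\<^sup>2 \<partial>M01)"
    by (rule nn_integral_cmult[symmetric]) measurable
  also have "\<dots> = (\<integral>\<^sup>+t. ennreal (B * cesaro_weight x * cmod (k x t) / cesaro_weight t) * (g t)\<^sup>2 \<partial>M01)"
  proof (rule nn_integral_cong)
    fix t assume "t \<in> space M01"
    then have p: "0 < cesaro_weight t" by (simp add: cesaro_weight_pos)
    have q: "0 \<le> B * cesaro_weight x"
      using schur_kernel_nonneg[OF k] cesaro_weight_pos[OF x] by simp
    have "(?v t)\<^sup>2 = ennreal (cmod (k x t) / cesaro_weight t) * (g t)\<^sup>2"
      using p by (simp add: power_mult_distrib ennreal_power)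
    then show "ennreal (B * cesaro_weight x) * (?v t)\<^sup>2 =
        ennreal (B * cesaro_weight x * cmod (k x t) / cesaro_weight t) * (g t)\<^sup>2"
      using p q by (simp add: ennreal_mult[symmetric] mult.assoc[symmetric])
  qed
  finally show ?thesis .
qed

text \<open>Integrating the pointwise bound over \<open>x\<close> and exchanging the integrals brings in the column bound.\<close>

lemma schur_test:
  fixes g :: "real \<Rightarrow> ennreal"
  assumes k: "schur_kernel B k" and g [measurable]: "g \<in> borel_measurable M01"
  shows "(\<integral>\<^sup>+x. (\<integral>\<^sup>+t. ennreal (cmod (k x t)) * g t \<partial>M01)\<^sup>2 \<partial>M01) \<le>
    ennreal (B\<^sup>2) * (\<integral>\<^sup>+t. (g t)\<^sup>2 \<partial>M01)"
proof -
  interpret finite_measure M01 by (rule finite_measure_M01)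
  interpret pair_sigma_finite M01 M01 ..
  note schur_kernel_measurable[OF k, measurable]
  let ?h = "\<lambda>x t. ennreal (B * cesaro_weight x * cmod (k x t) / cesaro_weight t) * (g t)\<^sup>2"
  have "(\<integral>\<^sup>+x. (\<integral>\<^sup>+t. ennreal (cmod (k x t)) * g t \<partial>M01)\<^sup>2 \<partial>M01) \<le>
      (\<integral>\<^sup>+x. (\<integral>\<^sup>+t. ?h x t \<partial>M01) \<partial>M01)"
    by (intro nn_integral_mono schur_pointwise[OF k g]) simp
  also have "\<dots> = (\<integral>\<^sup>+t. (\<integral>\<^sup>+x. ?h x t \<partial>M01) \<partial>M01)"
    by (rule Fubini'[symmetric]) measurable
  also have "\<dots> \<le> (\<integral>\<^sup>+t. ennreal (B\<^sup>2) * (g t)\<^sup>2 \<partial>M01)"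
  proof (rule nn_integral_mono)
    fix t assume "t \<in> space M01"
    then have t: "t \<in> {0<..<1}" by simp
    have p: "0 < cesaro_weight t" by (rule cesaro_weight_pos[OF t])
    have B: "0 \<le> B" by (rule schur_kernel_nonneg[OF k])
    have [measurable]: "(\<lambda>x. k x t) \<in> borel_measurable M01"
      using measurable_Pair1[OF schur_kernel_measurable[OF k], of t] t by simp
    have "(\<integral>\<^sup>+x. ?h x t \<partial>M01) =
        (\<integral>\<^sup>+x. (ennreal (B / cesaro_weight t) * (g t)\<^sup>2) * ennreal (cmod (k x t) * cesaro_weight x) \<partial>M01)"
    proof (rule nn_integral_cong)
      fix x assume "x \<in> space M01"
      then have "0 < cesaro_weight x" by (simp add: cesaro_weight_pos)
      then have "ennreal (B * cesaro_weight x * cmod (k x t) / cesaro_weight t) =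
          ennreal (B / cesaro_weight t) * ennreal (cmod (k x t) * cesaro_weight x)"
        using p B by (subst ennreal_mult[symmetric]) (auto simp: mult_ac)
      then show "?h x t = (ennreal (B / cesaro_weight t) * (g t)\<^sup>2) * ennreal (cmod (k x t) * cesaro_weight x)"
        by (simp add: mult_ac)
    qed
    also have "\<dots> = (ennreal (B / cesaro_weight t) * (g t)\<^sup>2) * (\<integral>\<^sup>+x. ennreal (cmod (k x t) * cesaro_weight x) \<partial>M01)"
      by (rule nn_integral_cmult) measurable
    also have "\<dots> \<le> (ennreal (B / cesaro_weight t) * (g t)\<^sup>2) * ennreal (B * cesaro_weight t)"
      by (intro mult_left_mono schur_column[OF k t]) simp
    also have "\<dots> = ennreal (B / cesaro_weight t) * ennreal (B * cesaro_weight t) * (g t)\<^sup>2"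
      by (simp add: mult_ac)
    also have "ennreal (B / cesaro_weight t) * ennreal (B * cesaro_weight t) = ennreal (B\<^sup>2)"
      using p B by (subst ennreal_mult[symmetric]) (auto simp: power2_eq_square)
    finally show "(\<integral>\<^sup>+x. ?h x t \<partial>M01) \<le> ennreal (B\<^sup>2) * (g t)\<^sup>2" .
  qed
  also have "\<dots> = ennreal (B\<^sup>2) * (\<integral>\<^sup>+t. (g t)\<^sup>2 \<partial>M01)"
    by (rule nn_integral_cmult) measurable
  finally show ?thesis .
qed

lemma square_integrable_iff_nn:
  "square_integrable f \<longleftrightarrow> f \<in> borel_measurable M01 \<and> (\<integral>\<^sup>+x. (ennreal (cmod (f x)))\<^sup>2 \<partial>M01) < \<infinity>"
proof (cases "f \<in> borel_measurable M01")
  case [measurable]: True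
  then show ?thesis
    by (simp add: square_integrable_def integrable_iff_bounded ennreal_power)
qed (simp add: square_integrable_def)

lemma kernel_fun_measurable:
  assumes k: "schur_kernel B k" and f [measurable]: "f \<in> borel_measurable M01"
  shows "kernel_fun k f \<in> borel_measurable M01"
proof -
  interpret finite_measure M01 by (rule finite_measure_M01)
  note schur_kernel_measurable[OF k, measurable]
  show ?thesis
    unfolding kernel_fun_def [abs_def] by measurable
qed

lemma AE_schur_finite:
  fixes g :: "real \<Rightarrow> ennreal"
  assumes k: "schur_kernel B k" and g [measurable]: "g \<in> borel_measurable M01"
    and fin: "(\<integral>\<^sup>+t. (g t)\<^sup>2 \<partial>M01) < \<infinity>"
  shows "AE x in M01. (\<integral>\<^sup>+t. ennreal (cmod (k x t)) * g t \<partial>M01) < \<infinity>"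
proof -
  interpret finite_measure M01 by (rule finite_measure_M01)
  note schur_kernel_measurable[OF k, measurable]
  have "(\<integral>\<^sup>+x. (\<integral>\<^sup>+t. ennreal (cmod (k x t)) * g t \<partial>M01)\<^sup>2 \<partial>M01) < \<infinity>"
    using fin by (intro le_less_trans[OF schur_test[OF k g]]) (simp add: ennreal_mult_less_top)
  then have "AE x in M01. (\<integral>\<^sup>+t. ennreal (cmod (k x t)) * g t \<partial>M01)\<^sup>2 \<noteq> \<infinity>"
    by (intro nn_integral_PInf_AE) auto
  then show ?thesis
    by eventually_elim (auto simp: less_top power2_eq_square ennreal_mult_eq_top_iff)
qed

lemma AE_integrable_kernel:
  assumes k: "schur_kernel B k" and f: "square_integrable f"
  shows "AE x in M01. integrable M01 (\<lambda>t. k x t * f t)"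
proof -
  have [measurable]: "f \<in> borel_measurable M01" using f by (rule square_integrable_measurable)
  have "AE x in M01. (\<integral>\<^sup>+t. ennreal (cmod (k x t)) * ennreal (cmod (f t)) \<partial>M01) < \<infinity>"
    using f by (intro AE_schur_finite[OF k]) (auto simp: square_integrable_iff_nn)
  moreover have "AE x in M01. x \<in> {0<..<1}" by (intro AE_I2) simp
  ultimately show ?thesis
  proof eventually_elim
    case (elim x)
    have [measurable]: "k x \<in> borel_measurable M01"
      by (rule schur_kernel_measurable_row[OF k elim(2)])
    show ?case
      using elim(1) by (intro integrableI_bounded) (measurable, simp add: norm_mult ennreal_mult)
  qed
qed

lemma square_integrable_kernel_fun:
  assumes k: "schur_kernel B k" and f: "square_integrable f"
  shows "square_integrable (kernel_fun k f)"
    and "(LINT x|M01. (cmod (kernel_fun k f x))\<^sup>2) \<le> B\<^sup>2 * (LINT x|M01. (cmod (f x))\<^sup>2)"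
proof -
  have [measurable]: "f \<in> borel_measurable M01" using f by (rule square_integrable_measurable)
  have m: "kernel_fun k f \<in> borel_measurable M01"
    by (rule kernel_fun_measurable[OF k]) measurable
  have "(\<integral>\<^sup>+x. (ennreal (cmod (kernel_fun k f x)))\<^sup>2 \<partial>M01) \<le>
      (\<integral>\<^sup>+x. (\<integral>\<^sup>+t. ennreal (cmod (k x t)) * ennreal (cmod (f t)) \<partial>M01)\<^sup>2 \<partial>M01)"
  proof (rule nn_integral_mono_AE)
    show "AE x in M01. (ennreal (cmod (kernel_fun k f x)))\<^sup>2 \<le>
        (\<integral>\<^sup>+t. ennreal (cmod (k x t)) * ennreal (cmod (f t)) \<partial>M01)\<^sup>2"
      using AE_integrable_kernel[OF k f]
    proof eventually_elim
      case (elim x)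
      have "ennreal (cmod (kernel_fun k f x)) \<le> (\<integral>\<^sup>+t. ennreal (cmod (k x t * f t)) \<partial>M01)"
        unfolding kernel_fun_def by (rule integral_norm_bound_ennreal[OF elim])
      then show ?case
        by (intro power_mono) (simp_all add: norm_mult ennreal_mult)
    qed
  qed
  also have "\<dots> \<le> ennreal (B\<^sup>2) * (\<integral>\<^sup>+t. (ennreal (cmod (f t)))\<^sup>2 \<partial>M01)"
    by (rule schur_test[OF k]) measurable
  also have "\<dots> = ennreal (B\<^sup>2 * (LINT x|M01. (cmod (f x))\<^sup>2))"
    using square_integrableD[OF f]
    by (simp add: ennreal_power nn_integral_eq_integral ennreal_mult)
  finally have *: "(\<integral>\<^sup>+x. (ennreal (cmod (kernel_fun k f x)))\<^sup>2 \<partial>M01) \<le>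
    ennreal (B\<^sup>2 * (LINT x|M01. (cmod (f x))\<^sup>2))" .
  then show s: "square_integrable (kernel_fun k f)"
    using le_less_trans[OF * ennreal_less_top] m by (simp add: square_integrable_iff_nn)
  show "(LINT x|M01. (cmod (kernel_fun k f x))\<^sup>2) \<le> B\<^sup>2 * (LINT x|M01. (cmod (f x))\<^sup>2)"
    using * square_integrableD[OF s]
    by (simp add: ennreal_power nn_integral_eq_integral ennreal_le_iff)
qed

lemma kernel_fun_cong_AE:
  assumes k: "schur_kernel B k" and "f \<in> borel_measurable M01" "g \<in> borel_measurable M01"
    and eq: "AE x in M01. f x = g x" and x: "x \<in> {0<..<1}"
  shows "kernel_fun k f x = kernel_fun k g x"
proof -
  note assms(2,3)[measurable]
  have [measurable]: "k x \<in> borel_measurable M01" by (rule schur_kernel_measurable_row[OF k x])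
  show ?thesis
    unfolding kernel_fun_def using eq by (intro integral_cong_AE) (auto elim: eventually_mono)
qed

text \<open>Fubini's theorem, pointwise for almost every \<open>x\<close>. Absolute convergence of the double integral comes
from applying the Schur test twice: \<open>g y = \<integral> |l y t| |f t| dt\<close> is square integrable by the test for
\<open>l\<close>, and then \<open>\<integral> |k x y| g y dy\<close> is finite for almost every \<open>x\<close> by the test for \<open>k\<close>.\<close>

lemma kernel_fun_compose:
  assumes k: "schur_kernel B k" and l: "schur_kernel B' l" and f: "square_integrable f"
    and kl: "\<And>x t. x \<in> {0<..<1} \<Longrightarrow> t \<in> {0<..<1} \<Longrightarrow> (LINT y|M01. k x y * l y t) = m x t"
  shows "AE x in M01. kernel_fun k (kernel_fun l f) x = kernel_fun m f x"
proof -
  interpret M: finite_measure M01 by (rule finite_measure_M01)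
  interpret pair_sigma_finite M01 M01 ..
  have [measurable]: "f \<in> borel_measurable M01" using f by (rule square_integrable_measurable)
  note schur_kernel_measurable[OF l, measurable]
  define g where "g y = (\<integral>\<^sup>+t. ennreal (cmod (l y t)) * ennreal (cmod (f t)) \<partial>M01)" for y
  have [measurable]: "g \<in> borel_measurable M01"
    unfolding g_def [abs_def] by measurable
  have "(\<integral>\<^sup>+y. (g y)\<^sup>2 \<partial>M01) < \<infinity>"
    unfolding g_def using f
    by (intro le_less_trans[OF schur_test[OF l]])
       (auto simp: square_integrable_iff_nn ennreal_mult_less_top)
  then have "AE x in M01. (\<integral>\<^sup>+y. ennreal (cmod (k x y)) * g y \<partial>M01) < \<infinity>"
    by (intro AE_schur_finite[OF k]) measurable
  moreover have "AE x in M01. x \<in> {0<..<1}" by (intro AE_I2) simp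
  ultimately show ?thesis
  proof eventually_elim
    case (elim x)
    have [measurable]: "k x \<in> borel_measurable M01"
      by (rule schur_kernel_measurable_row[OF k elim(2)])
    let ?F = "\<lambda>y t. k x y * l y t * f t"
    have "(\<integral>\<^sup>+p. ennreal (norm (case_prod ?F p)) \<partial>(M01 \<Otimes>\<^sub>M M01)) =
        (\<integral>\<^sup>+y. (\<integral>\<^sup>+t. ennreal (norm (?F y t)) \<partial>M01) \<partial>M01)"
      using M.nn_integral_fst[of "\<lambda>p. ennreal (norm (case_prod ?F p))" M01] by simp
    also have "\<dots> = (\<integral>\<^sup>+y. ennreal (cmod (k x y)) * g y \<partial>M01)"
    proof (rule nn_integral_cong)
      fix y assume "y \<in> space M01"
      then have [measurable]: "l y \<in> borel_measurable M01"
        by (intro schur_kernel_measurable_row[OF l]) simp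
      show "(\<integral>\<^sup>+t. ennreal (norm (?F y t)) \<partial>M01) = ennreal (cmod (k x y)) * g y"
        unfolding g_def
        by (subst nn_integral_cmult[symmetric]) (simp_all add: norm_mult ennreal_mult mult.assoc)
    qed
    also have "\<dots> < \<infinity>" by (rule elim(1))
    finally have "integrable (M01 \<Otimes>\<^sub>M M01) (case_prod ?F)"
      by (intro integrableI_bounded) measurable
    then have "(LINT t|M01. LINT y|M01. ?F y t) = (LINT y|M01. LINT t|M01. ?F y t)"
      by (rule Fubini_integral)
    also have "(LINT t|M01. LINT y|M01. ?F y t) = (LINT t|M01. (LINT y|M01. k x y * l y t) * f t)"
      by simp
    also have "\<dots> = kernel_fun m f x"
      unfolding kernel_fun_def using elim(2) by (intro Bochner_Integration.integral_cong) (simp_all add: kl)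
    also have "(LINT y|M01. LINT t|M01. ?F y t) = kernel_fun k (kernel_fun l f) x"
      unfolding kernel_fun_def by (simp add: mult.assoc)
    finally show ?case by simp
  qed
qed

section \<open>Kernel operators on the Hilbert space\<close>

lemma abs_L2_eq_iff:
  assumes "square_integrable f" "square_integrable g"
  shows "abs_L2 f = abs_L2 g \<longleftrightarrow> (AE x in M01. f x = g x)"
  using Quotient_rel[OF Quotient_L2, of f g] assms by auto

lemma L2_cases [case_names abs, cases type: L2]:
  obtains f where "square_integrable f" "F = abs_L2 f"
  by (induction F rule: L2.abs_induct) auto

lemma rep_L2:
  shows "square_integrable (rep_L2 F)" and "abs_L2 (rep_L2 F) = F"
  using Quotient_rep_reflp[OF Quotient_L2, of F] Quotient_abs_rep[OF Quotient_L2, of F] by auto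

lemma norm_abs_L2: "square_integrable f \<Longrightarrow> norm (abs_L2 f) = sqrt (LINT x|M01. (cmod (f x))\<^sup>2)"
  by (simp add: norm_L2.abs_eq)

definition kernel_operator :: "(real \<Rightarrow> real \<Rightarrow> complex) \<Rightarrow> L2 \<Rightarrow>\<^sub>L L2" where
  "kernel_operator k = Blinfun (\<lambda>F. abs_L2 (kernel_fun k (rep_L2 F)))"

lemma kernel_operator_abs:
  assumes k: "schur_kernel B k" and f: "square_integrable f"
  shows "kernel_operator k (abs_L2 f) = abs_L2 (kernel_fun k f)"
proof -
  define T where "T F = abs_L2 (kernel_fun k (rep_L2 F))" for F
  have T: "T (abs_L2 f) = abs_L2 (kernel_fun k f)" if f: "square_integrable f" for f
  proof -
    have "AE x in M01. rep_L2 (abs_L2 f) x = f x"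
      using rep_L2 f abs_L2_eq_iff by blast
    then have "AE x in M01. kernel_fun k (rep_L2 (abs_L2 f)) x = kernel_fun k f x"
      using rep_L2(1) f
      by (intro AE_I2, intro kernel_fun_cong_AE[OF k]) (simp_all add: square_integrable_measurable)
    then show ?thesis
      unfolding T_def using rep_L2(1) f
      by (subst abs_L2_eq_iff) (auto intro: square_integrable_kernel_fun[OF k])
  qed
  have "bounded_linear T"
  proof (rule bounded_linear_intro)
    fix F G :: L2 and c :: real
    obtain f where f: "square_integrable f" "F = abs_L2 f" by (cases F)
    obtain g where g: "square_integrable g" "G = abs_L2 g" by (cases G)
    have "AE x in M01. kernel_fun k (\<lambda>x. f x + g x) x = kernel_fun k f x + kernel_fun k g x"
      using AE_integrable_kernel[OF k f(1)] AE_integrable_kernel[OF k g(1)]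
      by eventually_elim (simp add: kernel_fun_def distrib_left)
    then have "abs_L2 (kernel_fun k (\<lambda>x. f x + g x)) = abs_L2 (\<lambda>x. kernel_fun k f x + kernel_fun k g x)"
      using f(1) g(1) by (subst abs_L2_eq_iff)
        (auto intro!: square_integrable_add square_integrable_kernel_fun(1)[OF k])
    then show "T (F + G) = T F + T G"
      using f g by (simp add: T plus_L2.abs_eq square_integrable_add square_integrable_kernel_fun(1)[OF k])
    have "kernel_fun k (\<lambda>x. c *\<^sub>R f x) = (\<lambda>x. c *\<^sub>R kernel_fun k f x)"
      by (simp add: kernel_fun_def fun_eq_iff)
    then show "T (c *\<^sub>R F) = c *\<^sub>R T F"
      using f by (simp add: T scaleR_L2.abs_eq square_integrable_scaleR square_integrable_kernel_fun(1)[OF k])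
    have "sqrt (LINT x|M01. (cmod (kernel_fun k f x))\<^sup>2) \<le> sqrt (B\<^sup>2 * (LINT x|M01. (cmod (f x))\<^sup>2))"
      by (intro real_sqrt_le_mono square_integrable_kernel_fun(2)[OF k f(1)])
    then show "norm (T F) \<le> norm F * B"
      using f schur_kernel_nonneg[OF k]
      by (simp add: T norm_abs_L2 square_integrable_kernel_fun(1)[OF k] real_sqrt_mult mult.commute)
  qed
  then show ?thesis
    unfolding kernel_operator_def using T[OF f] by (simp add: T_def [abs_def] bounded_linear_Blinfun_apply)
qed

lemma complex_linear_kernel_operator:
  assumes k: "schur_kernel B k"
  shows "complex_linear (kernel_operator k)"
  unfolding complex_linear_def
proof (intro allI)
  fix c F
  obtain f where f: "square_integrable f" "F = abs_L2 f" by (cases F)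
  have "kernel_fun k (\<lambda>x. c * f x) = (\<lambda>x. c * kernel_fun k f x)"
    by (simp add: kernel_fun_def fun_eq_iff mult.left_commute[of _ c])
  then show "kernel_operator k (c *\<^sub>C F) = c *\<^sub>C kernel_operator k F"
    using f by (simp add: kernel_operator_abs[OF k] scaleC.abs_eq square_integrable_cmult
        square_integrable_kernel_fun(1)[OF k])
qed

section \<open>Power functions in the logit variable\<close>

text \<open>In the variable \<open>s = x / (1 - x)\<close> the functions \<open>exp (c * logit x)\<close> are the complex powers of \<open>s\<close>,
and \<open>dx / (x (1 - x)) = ds / s\<close>.\<close>

definition logit :: "real \<Rightarrow> real" where
  "logit x = ln (x / (1 - x))"

lemma logit_measurable [measurable]: "logit \<in> borel_measurable borel"
  unfolding logit_def [abs_def] by measurable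

lemma exp_logit: "x \<in> {0<..<1} \<Longrightarrow> exp (logit x) = x / (1 - x)"
  by (simp add: logit_def)

lemma logit_has_derivative:
  assumes "x \<in> {0<..<1}"
  shows "(logit has_real_derivative 1 / (x * (1 - x))) (at x)"
  unfolding logit_def [abs_def] using assms
  by (auto intro!: derivative_eq_intros simp: divide_simps)

lemma isCont_logit: "x \<in> {0<..<1} \<Longrightarrow> isCont logit x"
  using logit_has_derivative DERIV_isCont by blast

lemma filterlim_logit_0: "filterlim logit at_bot (at_right 0)"
  unfolding logit_def [abs_def]
proof (rule filterlim_compose[OF ln_at_0])
  have "((\<lambda>x::real. x / (1 - x)) \<longlongrightarrow> 0 / (1 - 0)) (at_right 0)"
    by (intro tendsto_intros) auto
  moreover have "\<forall>\<^sub>F x in at_right (0::real). x / (1 - x) > 0"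
    using eventually_at_right_real[of 0 1] by (auto elim: eventually_mono)
  ultimately show "filterlim (\<lambda>x::real. x / (1 - x)) (at_right 0) (at_right 0)"
    by (auto simp: filterlim_at elim: eventually_mono)
qed

lemma filterlim_logit_1: "filterlim logit at_top (at_left 1)"
  unfolding logit_def [abs_def]
proof (rule filterlim_compose[OF ln_at_top], rule LIM_at_top_divide)
  show "((\<lambda>x::real. x) \<longlongrightarrow> 1) (at_left 1)" by (rule tendsto_ident_at)
  show "((\<lambda>x::real. 1 - x) \<longlongrightarrow> 0) (at_left 1)" by (auto intro!: tendsto_eq_intros)
  show "\<forall>\<^sub>F x in at_left (1::real). 0 < 1 - x"
    by (auto simp: eventually_at_filter)
qed simp

lemma cmod_exp_logit: "cmod (exp (c * of_real (logit y))) = exp (Re c * logit y)"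
  by (simp add: norm_exp_eq_Re)

lemma exp_logit_tendsto_0:
  assumes "0 < Re c"
  shows "((\<lambda>y. exp (c * of_real (logit y))) \<longlongrightarrow> 0) (at_right 0)"
proof (rule tendsto_norm_zero_cancel, unfold cmod_exp_logit)
  have "filterlim (\<lambda>y. Re c * logit y) at_bot (at_right 0)"
    by (rule filterlim_tendsto_pos_mult_at_bot[OF tendsto_const assms filterlim_logit_0])
  then show "((\<lambda>y. exp (Re c * logit y)) \<longlongrightarrow> 0) (at_right 0)"
    by (rule filterlim_compose[OF exp_at_bot])
qed

lemma exp_logit_tendsto_1:
  assumes "Re c < 0"
  shows "((\<lambda>y. exp (c * of_real (logit y))) \<longlongrightarrow> 0) (at_left 1)"
proof (rule tendsto_norm_zero_cancel, unfold cmod_exp_logit)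
  have "filterlim (\<lambda>y. Re c * logit y) at_bot (at_left 1)"
    by (rule filterlim_tendsto_neg_mult_at_bot[OF tendsto_const assms filterlim_logit_1])
  then show "((\<lambda>y. exp (Re c * logit y)) \<longlongrightarrow> 0) (at_left 1)"
    by (rule filterlim_compose[OF exp_at_bot])
qed

lemma exp_logit_tendsto:
  fixes c :: complex
  assumes "x \<in> {0<..<1}"
  shows "((\<lambda>y. exp (c * of_real (logit y))) \<longlongrightarrow> exp (c * of_real (logit x))) (at x within S)"
  using isCont_logit[OF assms]
  by (intro tendsto_intros) (auto simp: isCont_def intro: tendsto_within_subset)

lemma Re_tendsto_exp_logit:
  assumes "((\<lambda>y. exp (of_real r * of_real (logit y))) \<longlongrightarrow> (A::complex)) F"
  shows "((\<lambda>y. exp (r * logit y)) \<longlongrightarrow> Re A) F"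
  using tendsto_Re[OF assms] by (simp add: Re_exp)

lemma has_bochner_integral_M01:
  fixes g :: "real \<Rightarrow> 'a :: {banach, second_countable_topology}"
  assumes int: "set_integrable lborel {l<..<u} g" and lu: "0 \<le> l" "u \<le> 1"
  shows "has_bochner_integral M01 (\<lambda>y. if l < y \<and> y < u then g y else 0) (LBINT y:{l<..<u}. g y)"
proof -
  have eq: "(\<lambda>y. indicator {0<..<1} y *\<^sub>R (if l < y \<and> y < u then g y else 0)) =
      (\<lambda>y. indicator {l<..<u} y *\<^sub>R g y)"
    using lu by (auto simp: fun_eq_iff indicator_def)
  have i: "integrable lborel (\<lambda>y. indicator {l<..<u} y *\<^sub>R g y)"
    using int by (simp add: set_integrable_def)
  then have m: "(\<lambda>y. indicator {l<..<u} y *\<^sub>R g y) \<in> borel_measurable lborel"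
    by (rule borel_measurable_integrable)
  show ?thesis
    using i m
    by (simp add: has_bochner_integral_iff integrable_restrict_space integral_restrict_space eq
        integrable_completion integral_completion set_lebesgue_integral_def)
qed

text \<open>For a real exponent the integrand is nonnegative, so the fundamental theorem of calculus on the open
interval yields integrability along with the value. The limits at the end points are assumed for the
complex-valued function so that the same limit lemmas serve real and complex exponents.\<close>

lemma has_bochner_integral_exp_logit_real:
  fixes r :: real
  assumes lu: "0 \<le> l" "l < u" "u \<le> 1" and r: "r \<noteq> 0"
    and A: "((\<lambda>y. exp (of_real r * of_real (logit y))) \<longlongrightarrow> (A::complex)) (at_right l)"
    and B: "((\<lambda>y. exp (of_real r * of_real (logit y))) \<longlongrightarrow> (B::complex)) (at_left u)"
  shows "set_integrable lborel {l<..<u} (\<lambda>y. exp (r * logit y) / (y * (1 - y)))"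
    and "has_bochner_integral M01
      (\<lambda>y. if l < y \<and> y < u then exp (r * logit y) / (y * (1 - y)) else 0) ((Re B - Re A) / r)"
proof -
  have l: "ereal l < ereal u" using lu by simp
  let ?f = "\<lambda>y. exp (r * logit y) / (y * (1 - y))"
  let ?F = "\<lambda>y. exp (r * logit y) / r"
  have d: "(?F has_real_derivative ?f y) (at y)" if "ereal l < ereal y" "ereal y < ereal u" for y
    using that lu r by (auto intro!: derivative_eq_intros logit_has_derivative)
  have c: "isCont ?f y" if "ereal l < ereal y" "ereal y < ereal u" for y
    using that lu by (intro continuous_intros isCont_logit) auto
  have n: "AE y in lborel. ereal l < ereal y \<longrightarrow> ereal y < ereal u \<longrightarrow> 0 \<le> ?f y"
    using lu by auto
  have a: "((?F \<circ> real_of_ereal) \<longlongrightarrow> Re A / r) (at_right (ereal l))"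
    unfolding ereal_tendsto_simps1
    using r by (intro tendsto_divide Re_tendsto_exp_logit[OF A] tendsto_const)
  have b: "((?F \<circ> real_of_ereal) \<longlongrightarrow> Re B / r) (at_left (ereal u))"
    unfolding ereal_tendsto_simps1
    using r by (intro tendsto_divide Re_tendsto_exp_logit[OF B] tendsto_const)
  note * = interval_integral_FTC_nonneg[OF l d c n a b]
  show i: "set_integrable lborel {l<..<u} ?f"
    using *(1) by simp
  have "(LBINT y:{l<..<u}. ?f y) = (Re B - Re A) / r"
    using *(2) lu by (simp add: interval_integral_Ioo diff_divide_distrib)
  with has_bochner_integral_M01[OF i lu(1,3)]
  show "has_bochner_integral M01 (\<lambda>y. if l < y \<and> y < u then ?f y else 0) ((Re B - Re A) / r)"
    by simp
qed

lemma has_bochner_integral_exp_logit: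
  fixes c :: complex
  assumes lu: "0 \<le> l" "l < u" "u \<le> 1" and c: "c \<noteq> 0"
    and i: "set_integrable lborel {l<..<u} (\<lambda>y. exp (Re c * logit y) / (y * (1 - y)))"
    and A: "((\<lambda>y. exp (c * of_real (logit y))) \<longlongrightarrow> A) (at_right l)"
    and B: "((\<lambda>y. exp (c * of_real (logit y))) \<longlongrightarrow> B) (at_left u)"
  shows "has_bochner_integral M01
    (\<lambda>y. if l < y \<and> y < u then exp (c * of_real (logit y)) / of_real (y * (1 - y)) else 0) ((B - A) / c)"
proof -
  have l: "ereal l < ereal u" using lu by simp
  let ?f = "\<lambda>y. exp (c * of_real (logit y)) / of_real (y * (1 - y))"
  let ?F = "\<lambda>y. exp (c * of_real (logit y)) / c"
  have d: "(?F has_vector_derivative ?f y) (at y)" if "ereal l < ereal y" "ereal y < ereal u" for y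
  proof -
    have y: "y \<in> {0<..<1}" using that lu by auto
    have "((\<lambda>y. c * of_real (logit y)) has_vector_derivative c * of_real (1 / (y * (1 - y)))) (at y)"
      using logit_has_derivative[OF y]
      by (intro has_vector_derivative_mult_right has_vector_derivative_of_real)
         (simp add: has_real_derivative_iff_has_vector_derivative)
    moreover have "((\<lambda>z. exp z / c) has_field_derivative exp (c * of_real (logit y)) / c) (at (c * of_real (logit y)))"
      using c by (auto intro!: derivative_eq_intros)
    ultimately have "(((\<lambda>z. exp z / c) \<circ> (\<lambda>y. c * of_real (logit y))) has_vector_derivative
        (c * of_real (1 / (y * (1 - y)))) * (exp (c * of_real (logit y)) / c)) (at y)"
      by (rule field_vector_diff_chain_at)
    then show ?thesis
      using c y by (simp add: o_def field_simps)
  qed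
  have cont: "isCont ?f y" if "ereal l < ereal y" "ereal y < ereal u" for y
    using that lu by (intro continuous_intros isCont_logit) auto
  have s: "set_integrable lborel {l<..<u} ?f"
    unfolding set_integrable_def
  proof (rule Bochner_Integration.integrable_bound[OF i[unfolded set_integrable_def]])
    show "(\<lambda>y. indicator {l<..<u} y *\<^sub>R ?f y) \<in> borel_measurable lborel" by measurable
    show "AE y in lborel. norm (indicator {l<..<u} y *\<^sub>R ?f y) \<le>
        norm (indicator {l<..<u} y *\<^sub>R (exp (Re c * logit y) / (y * (1 - y))))"
      unfolding norm_scaleR norm_divide cmod_exp_logit norm_of_real by (intro AE_I2) simp
  qed
  have a: "((?F \<circ> real_of_ereal) \<longlongrightarrow> A / c) (at_right (ereal l))"
    unfolding ereal_tendsto_simps1 using c by (intro tendsto_divide A tendsto_const)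
  have b: "((?F \<circ> real_of_ereal) \<longlongrightarrow> B / c) (at_left (ereal u))"
    unfolding ereal_tendsto_simps1 using c by (intro tendsto_divide B tendsto_const)
  have "(LBINT y=ereal l..ereal u. ?f y) = B / c - A / c"
    using s by (intro interval_integral_FTC_integrable[OF l d cont _ a b]) simp_all
  then have "(LBINT y:{l<..<u}. ?f y) = (B - A) / c"
    using lu by (simp add: interval_integral_Ioo diff_divide_distrib)
  with has_bochner_integral_M01[OF s lu(1,3)] show ?thesis by simp
qed

lemma has_bochner_integral_exp_logit_below:
  assumes c: "0 < Re c" and u: "u \<in> {0<..<1}"
  shows "has_bochner_integral M01
    (\<lambda>y. if y < u then exp (c * of_real (logit y)) / of_real (y * (1 - y)) else 0)
    (exp (c * of_real (logit u)) / c)"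
proof -
  have "set_integrable lborel {0<..<u} (\<lambda>y. exp (Re c * logit y) / (y * (1 - y)))"
    using c u
    by (intro has_bochner_integral_exp_logit_real(1)[OF _ _ _ _ exp_logit_tendsto_0 exp_logit_tendsto]) auto
  then have "has_bochner_integral M01
      (\<lambda>y. if 0 < y \<and> y < u then exp (c * of_real (logit y)) / of_real (y * (1 - y)) else 0)
      ((exp (c * of_real (logit u)) - 0) / c)"
    using c u
    by (intro has_bochner_integral_exp_logit exp_logit_tendsto_0 exp_logit_tendsto) auto
  then show ?thesis
    by (rule has_bochner_integral_cong[THEN iffD1, rotated -1]) auto
qed

lemma has_bochner_integral_exp_logit_above:
  assumes c: "Re c < 0" and l: "l \<in> {0<..<1}"
  shows "has_bochner_integral M01
    (\<lambda>y. if l < y then exp (c * of_real (logit y)) / of_real (y * (1 - y)) else 0)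
    (- exp (c * of_real (logit l)) / c)"
proof -
  have "set_integrable lborel {l<..<1} (\<lambda>y. exp (Re c * logit y) / (y * (1 - y)))"
    using c l
    by (intro has_bochner_integral_exp_logit_real(1)[OF _ _ _ _ exp_logit_tendsto exp_logit_tendsto_1]) auto
  then have "has_bochner_integral M01
      (\<lambda>y. if l < y \<and> y < 1 then exp (c * of_real (logit y)) / of_real (y * (1 - y)) else 0)
      ((0 - exp (c * of_real (logit l))) / c)"
    using c l
    by (intro has_bochner_integral_exp_logit exp_logit_tendsto_1 exp_logit_tendsto) auto
  then show ?thesis
    by (rule has_bochner_integral_cong[THEN iffD1, rotated -1]) auto
qed

lemma has_bochner_integral_exp_logit_between:
  fixes c :: complex
  assumes c: "c \<noteq> 0" and lu: "l \<in> {0<..<1}" "u \<in> {0<..<1}" "l < u"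
  shows "has_bochner_integral M01
    (\<lambda>y. if l < y \<and> y < u then exp (c * of_real (logit y)) / of_real (y * (1 - y)) else 0)
    ((exp (c * of_real (logit u)) - exp (c * of_real (logit l))) / c)"
proof -
  have "continuous_on {l..u} (\<lambda>y. exp (Re c * logit y) / (y * (1 - y)))"
    using lu by (intro continuous_at_imp_continuous_on ballI continuous_intros isCont_logit) auto
  then have "set_integrable lborel {l..u} (\<lambda>y. exp (Re c * logit y) / (y * (1 - y)))"
    by (rule borel_integrable_atLeastAtMost')
  then have "set_integrable lborel {l<..<u} (\<lambda>y. exp (Re c * logit y) / (y * (1 - y)))"
    by (rule set_integrable_subset) auto
  then show ?thesis
    using c lu by (intro has_bochner_integral_exp_logit exp_logit_tendsto) auto
qed

lemma nn_integral_exp_logit_below: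
  assumes "0 < r" "u \<in> {0<..<1}"
  shows "(\<integral>\<^sup>+y. ennreal (if y < u then exp (r * logit y) / (y * (1 - y)) else 0) \<partial>M01) =
    ennreal (exp (r * logit u) / r)"
proof -
  have "has_bochner_integral M01
      (\<lambda>y. if 0 < y \<and> y < u then exp (r * logit y) / (y * (1 - y)) else 0)
      ((Re (exp (of_real r * of_real (logit u))) - Re 0) / r)"
    using assms
    by (intro has_bochner_integral_exp_logit_real(2)[OF _ _ _ _ exp_logit_tendsto_0 exp_logit_tendsto]) auto
  then have "has_bochner_integral M01
      (\<lambda>y. if y < u then exp (r * logit y) / (y * (1 - y)) else 0) (exp (r * logit u) / r)"
    by (subst (asm) has_bochner_integral_cong[OF refl _ refl]) (auto simp: Re_exp)
  then show ?thesis
    by (subst nn_integral_eq_integral) (auto simp: has_bochner_integral_iff)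
qed

lemma nn_integral_exp_logit_above:
  assumes "0 < r" "l \<in> {0<..<1}"
  shows "(\<integral>\<^sup>+y. ennreal (if l < y then exp (- r * logit y) / (y * (1 - y)) else 0) \<partial>M01) =
    ennreal (exp (- r * logit l) / r)"
proof -
  have "has_bochner_integral M01
      (\<lambda>y. if l < y \<and> y < 1 then exp (- r * logit y) / (y * (1 - y)) else 0)
      ((Re 0 - Re (exp (of_real (- r) * of_real (logit l)))) / - r)"
    using assms
    by (intro has_bochner_integral_exp_logit_real(2)[OF _ _ _ _ exp_logit_tendsto exp_logit_tendsto_1]) auto
  then have "has_bochner_integral M01
      (\<lambda>y. if l < y then exp (- r * logit y) / (y * (1 - y)) else 0) (exp (- r * logit l) / r)"
    by (subst (asm) has_bochner_integral_cong[OF refl _ refl]) (auto simp: Re_exp)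
  then show ?thesis
    by (subst nn_integral_eq_integral) (auto simp: has_bochner_integral_iff)
qed

lemma AE_M01_neq: "AE y in M01. y \<noteq> t"
  using AE_completion[OF AE_lborel_singleton[of t]]
  by (auto simp: AE_restrict_space_iff elim: eventually_mono)

section \<open>The kernels behind the resolvent\<close>

text \<open>With \<open>s\<close> and \<open>u\<close> the values of \<open>x / (1 - x)\<close> and \<open>t / (1 - t)\<close>, this is
\<open>(s / u) powr a / (x (1 - t))\<close>. The Cesaro kernel is the case \<open>a = 0\<close> restricted to \<open>t < x\<close>.\<close>

definition power_kernel :: "complex \<Rightarrow> real \<Rightarrow> real \<Rightarrow> complex" where
  "power_kernel a x t = exp (a * of_real (logit x - logit t)) / of_real (x * (1 - t))"

definition lower_kernel :: "complex \<Rightarrow> real \<Rightarrow> real \<Rightarrow> complex" where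
  "lower_kernel a x t = (if t < x then power_kernel a x t else 0)"

text \<open>The diagonal belongs to the upper kernel, so that the composition formulas below hold at every point.\<close>

definition upper_kernel :: "complex \<Rightarrow> real \<Rightarrow> real \<Rightarrow> complex" where
  "upper_kernel a x t = (if x \<le> t then power_kernel a x t else 0)"

lemma cmod_power_kernel:
  assumes "x \<in> {0<..<1}" "t \<in> {0<..<1}"
  shows "cmod (power_kernel a x t) = exp (Re a * (logit x - logit t)) / (x * (1 - t))"
  unfolding power_kernel_def norm_divide cmod_exp_logit norm_of_real norm_exp_eq_Re
  using assms by simp

text \<open>The two forms absorb, respectively, the factor \<open>1 / x\<close> and the factor \<open>1 / (1 - t)\<close> of the kernel.\<close>

lemma cesaro_weight_logit:
  assumes x: "x \<in> {0<..<1}"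
  shows "cesaro_weight x = exp (logit x / 2) / x" "cesaro_weight x = exp (- (logit x / 2)) / (1 - x)"
proof -
  have e: "exp (logit x / 2) = sqrt x / sqrt (1 - x)"
  proof -
    have "(exp (logit x / 2))\<^sup>2 = x / (1 - x)"
      using x by (simp add: power2_eq_square exp_logit flip: exp_add)
    then have "exp (logit x / 2) = sqrt (x / (1 - x))"
      by (metis real_sqrt_unique exp_ge_zero)
    then show ?thesis by (simp add: real_sqrt_divide)
  qed
  have s: "sqrt x * sqrt x = x" "sqrt (1 - x) * sqrt (1 - x) = 1 - x" "sqrt x \<noteq> 0" "sqrt (1 - x) \<noteq> 0"
    using x by auto
  show "cesaro_weight x = exp (logit x / 2) / x"
    unfolding cesaro_weight_def real_sqrt_mult e using s x
    by (simp add: divide_simps)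
  show "cesaro_weight x = exp (- (logit x / 2)) / (1 - x)"
    unfolding cesaro_weight_def real_sqrt_mult exp_minus e using s x
    by (simp add: divide_simps)
qed

lemma power_kernel_weight_row:
  assumes x: "x \<in> {0<..<1}" and t: "t \<in> {0<..<1}"
  shows "cmod (power_kernel a x t) * cesaro_weight t =
    (exp (Re a * logit x) / x) * (exp ((1 / 2 - Re a) * logit t) / (t * (1 - t)))"
  unfolding cmod_power_kernel[OF x t] cesaro_weight_logit(1)[OF t]
  using x t by (simp add: field_simps flip: exp_add)

lemma power_kernel_weight_column:
  assumes x: "x \<in> {0<..<1}" and t: "t \<in> {0<..<1}"
  shows "cmod (power_kernel a x t) * cesaro_weight x =
    (exp (- Re a * logit t) / (1 - t)) * (exp (- (1 / 2 - Re a) * logit x) / (x * (1 - x)))"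
  unfolding cmod_power_kernel[OF x t] cesaro_weight_logit(2)[OF x]
  using x t by (simp add: field_simps flip: exp_add)

lemma power_kernel_measurable:
  "(\<lambda>(x, t). power_kernel a x t) \<in> borel_measurable (M01 \<Otimes>\<^sub>M M01)"
  "(\<lambda>(x, t). lower_kernel a x t) \<in> borel_measurable (M01 \<Otimes>\<^sub>M M01)"
  "(\<lambda>(x, t). upper_kernel a x t) \<in> borel_measurable (M01 \<Otimes>\<^sub>M M01)"
proof -
  have [measurable]: "fst \<in> borel_measurable (M01 \<Otimes>\<^sub>M M01)" "snd \<in> borel_measurable (M01 \<Otimes>\<^sub>M M01)"
    using measurable_compose[OF measurable_fst measurable_M01_id, of M01]
      measurable_compose[OF measurable_snd measurable_M01_id, of M01] by (simp_all add: comp_def)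
  show "(\<lambda>(x, t). power_kernel a x t) \<in> borel_measurable (M01 \<Otimes>\<^sub>M M01)"
    unfolding power_kernel_def split_beta by measurable
  then show "(\<lambda>(x, t). lower_kernel a x t) \<in> borel_measurable (M01 \<Otimes>\<^sub>M M01)"
    "(\<lambda>(x, t). upper_kernel a x t) \<in> borel_measurable (M01 \<Otimes>\<^sub>M M01)"
    unfolding lower_kernel_def upper_kernel_def split_beta by measurable
qed

lemma nn_integral_cmult_le:
  assumes "0 \<le> c" and [measurable]: "h \<in> borel_measurable M"
    and le: "AE y in M. f y \<le> c * h y" and h: "(\<integral>\<^sup>+y. ennreal (h y) \<partial>M) = ennreal v"
  shows "(\<integral>\<^sup>+y. ennreal (f y) \<partial>M) \<le> ennreal (c * v)"
proof -
  have "(\<integral>\<^sup>+y. ennreal (f y) \<partial>M) \<le> (\<integral>\<^sup>+y. ennreal c * ennreal (h y) \<partial>M)"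
    using le by (intro nn_integral_mono_AE, eventually_elim)
      (simp add: ennreal_mult'[OF assms(1), symmetric] ennreal_leI)
  also have "\<dots> = ennreal (c * v)"
    using assms(1) h by (simp add: nn_integral_cmult ennreal_mult')
  finally show ?thesis .
qed

text \<open>Weighted by \<open>exp (logit t / 2) / t\<close>, the kernel becomes a multiple of
\<open>exp ((1 / 2 - Re a) * logit t) / (t (1 - t))\<close>, which is integrable near \<open>t = 0\<close> exactly when
\<open>Re a < 1 / 2\<close>. The upper kernel asks for integrability near the other end point, hence for the
opposite inequality.\<close>

lemma schur_kernel_lower:
  assumes a: "Re a < 1 / 2"
  shows "schur_kernel (1 / (1 / 2 - Re a)) (lower_kernel a)"
  unfolding schur_kernel_def
proof (intro conjI ballI)
  let ?r = "1 / 2 - Re a"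
  have r: "0 < ?r" using a by simp
  note measurable_M01_id [measurable]
  show "0 \<le> 1 / ?r" using r by simp
  show "(\<lambda>(x, t). lower_kernel a x t) \<in> borel_measurable (M01 \<Otimes>\<^sub>M M01)"
    by (rule power_kernel_measurable)
  show "(\<integral>\<^sup>+t. ennreal (cmod (lower_kernel a x t) * cesaro_weight t) \<partial>M01) \<le>
      ennreal (1 / ?r * cesaro_weight x)" if x: "x \<in> {0<..<1}" for x
  proof -
    have "(\<integral>\<^sup>+t. ennreal (cmod (lower_kernel a x t) * cesaro_weight t) \<partial>M01) \<le>
        ennreal ((exp (Re a * logit x) / x) * (exp (?r * logit x) / ?r))"
    proof (rule nn_integral_cmult_le[OF _ _ AE_I2 nn_integral_exp_logit_below[OF r x]])
      fix t assume "t \<in> space M01"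
      then show "cmod (lower_kernel a x t) * cesaro_weight t \<le> (exp (Re a * logit x) / x) *
          (if t < x then exp (?r * logit t) / (t * (1 - t)) else 0)"
        using x by (simp add: lower_kernel_def power_kernel_weight_row) (simp add: mult_ac)
    qed (use x in simp, measurable)
    also have "(exp (Re a * logit x) / x) * (exp (?r * logit x) / ?r) = 1 / ?r * cesaro_weight x"
      unfolding cesaro_weight_logit(1)[OF x] by (simp add: field_simps flip: exp_add)
    finally show ?thesis .
  qed
  show "(\<integral>\<^sup>+x. ennreal (cmod (lower_kernel a x t) * cesaro_weight x) \<partial>M01) \<le>
      ennreal (1 / ?r * cesaro_weight t)" if t: "t \<in> {0<..<1}" for t
  proof -
    have "(\<integral>\<^sup>+x. ennreal (cmod (lower_kernel a x t) * cesaro_weight x) \<partial>M01) \<le>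
        ennreal ((exp (- Re a * logit t) / (1 - t)) * (exp (- ?r * logit t) / ?r))"
    proof (rule nn_integral_cmult_le[OF _ _ AE_I2 nn_integral_exp_logit_above[OF r t]])
      fix x assume "x \<in> space M01"
      then show "cmod (lower_kernel a x t) * cesaro_weight x \<le> (exp (- Re a * logit t) / (1 - t)) *
          (if t < x then exp (- ?r * logit x) / (x * (1 - x)) else 0)"
        using t by (simp add: lower_kernel_def power_kernel_weight_column) (simp add: mult_ac)
    qed (use t in simp, measurable)
    also have "(exp (- Re a * logit t) / (1 - t)) * (exp (- ?r * logit t) / ?r) = 1 / ?r * cesaro_weight t"
      unfolding cesaro_weight_logit(2)[OF t] by (simp add: field_simps flip: exp_add)
    finally show ?thesis .
  qed
qed

lemma schur_kernel_upper:
  assumes a: "1 / 2 < Re a"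
  shows "schur_kernel (1 / (Re a - 1 / 2)) (upper_kernel a)"
  unfolding schur_kernel_def
proof (intro conjI ballI)
  let ?r = "Re a - 1 / 2"
  have r: "0 < ?r" using a by simp
  note measurable_M01_id [measurable]
  show "0 \<le> 1 / ?r" using r by simp
  show "(\<lambda>(x, t). upper_kernel a x t) \<in> borel_measurable (M01 \<Otimes>\<^sub>M M01)"
    by (rule power_kernel_measurable)
  show "(\<integral>\<^sup>+t. ennreal (cmod (upper_kernel a x t) * cesaro_weight t) \<partial>M01) \<le>
      ennreal (1 / ?r * cesaro_weight x)" if x: "x \<in> {0<..<1}" for x
  proof -
    have "(\<integral>\<^sup>+t. ennreal (cmod (upper_kernel a x t) * cesaro_weight t) \<partial>M01) \<le>
        ennreal ((exp (Re a * logit x) / x) * (exp (- ?r * logit x) / ?r))"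
    proof (rule nn_integral_cmult_le[OF _ _ _ nn_integral_exp_logit_above[OF r x]])
      have "AE t in M01. t \<in> {0<..<1}" by (intro AE_I2) simp
      with AE_M01_neq[of x]
      show "AE t in M01. cmod (upper_kernel a x t) * cesaro_weight t \<le> (exp (Re a * logit x) / x) *
          (if x < t then exp (- ?r * logit t) / (t * (1 - t)) else 0)"
        by eventually_elim (use x in \<open>simp add: upper_kernel_def power_kernel_weight_row, simp add: mult_ac\<close>)
    qed (use x in simp, measurable)
    also have "(exp (Re a * logit x) / x) * (exp (- ?r * logit x) / ?r) = 1 / ?r * cesaro_weight x"
      unfolding cesaro_weight_logit(1)[OF x] using r by (simp add: field_simps flip: exp_add)
    finally show ?thesis .
  qed
  show "(\<integral>\<^sup>+x. ennreal (cmod (upper_kernel a x t) * cesaro_weight x) \<partial>M01) \<le>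
      ennreal (1 / ?r * cesaro_weight t)" if t: "t \<in> {0<..<1}" for t
  proof -
    have "(\<integral>\<^sup>+x. ennreal (cmod (upper_kernel a x t) * cesaro_weight x) \<partial>M01) \<le>
        ennreal ((exp (- Re a * logit t) / (1 - t)) * (exp (?r * logit t) / ?r))"
    proof (rule nn_integral_cmult_le[OF _ _ _ nn_integral_exp_logit_below[OF r t]])
      have "AE x in M01. x \<in> {0<..<1}" by (intro AE_I2) simp
      with AE_M01_neq[of t]
      show "AE x in M01. cmod (upper_kernel a x t) * cesaro_weight x \<le> (exp (- Re a * logit t) / (1 - t)) *
          (if x < t then exp (?r * logit x) / (x * (1 - x)) else 0)"
        by eventually_elim (use t in \<open>simp add: upper_kernel_def power_kernel_weight_column, simp add: mult_ac\<close>)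
    qed (use t in simp, measurable)
    also have "(exp (- Re a * logit t) / (1 - t)) * (exp (?r * logit t) / ?r) = 1 / ?r * cesaro_weight t"
      unfolding cesaro_weight_logit(2)[OF t] using r by (simp add: field_simps flip: exp_add)
    finally show ?thesis .
  qed
qed

text \<open>The intermediate variable separates: up to a factor in \<open>x\<close> and \<open>t\<close>, the product is again a power in
the logit variable times \<open>1 / (y (1 - y))\<close>, which has an elementary antiderivative.\<close>

lemma power_kernel_mult:
  assumes "x \<in> {0<..<1}" "y \<in> {0<..<1}" "t \<in> {0<..<1}"
  shows "power_kernel a x y * power_kernel b y t =
    exp (a * of_real (logit x) - b * of_real (logit t)) / of_real (x * (1 - t)) *
    (exp ((b - a) * of_real (logit y)) / of_real (y * (1 - y)))"
proof -
  have "exp (a * of_real (logit x - logit y)) * exp (b * of_real (logit y - logit t)) =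
      exp (a * of_real (logit x) - b * of_real (logit t)) * exp ((b - a) * of_real (logit y))"
    by (simp add: algebra_simps flip: exp_add)
  then show ?thesis
    unfolding power_kernel_def times_divide_times_eq by (simp add: mult_ac)
qed

lemma power_kernel_collapse:
  "exp (a * of_real (logit x) - b * of_real (logit t)) / of_real (x * (1 - t)) *
    exp ((b - a) * of_real (logit x)) = power_kernel b x t"
  "exp (a * of_real (logit x) - b * of_real (logit t)) / of_real (x * (1 - t)) *
    exp ((b - a) * of_real (logit t)) = power_kernel a x t"
  unfolding power_kernel_def times_divide_eq_left exp_add[symmetric]
  by (simp_all add: algebra_simps)

text \<open>The resolvent identity in terms of kernels: \<open>lower_kernel a\<close> depends on \<open>a\<close> as a resolvent does on the
spectral parameter. Each bound of the integration interval contributes one of the two kernels.\<close>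

lemma lower_lower_compose:
  assumes ab: "a \<noteq> b" and x: "x \<in> {0<..<1}" and t: "t \<in> {0<..<1}"
  shows "(LINT y|M01. lower_kernel a x y * lower_kernel b y t) =
    (lower_kernel b x t - lower_kernel a x t) / (b - a)"
proof (cases "t < x")
  case True
  let ?K = "exp (a * of_real (logit x) - b * of_real (logit t)) / of_real (x * (1 - t))"
  let ?h = "\<lambda>y. if t < y \<and> y < x then exp ((b - a) * of_real (logit y)) / of_real (y * (1 - y)) else 0"
  have "(LINT y|M01. lower_kernel a x y * lower_kernel b y t) = (LINT y|M01. ?K * ?h y)"
    using x t by (intro Bochner_Integration.integral_cong)
      (auto simp: lower_kernel_def power_kernel_mult simp del: of_real_mult of_real_diff)
  also have "\<dots> = ?K * (LINT y|M01. ?h y)"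
    by (rule integral_mult_right_zero)
  also have "(LINT y|M01. ?h y) =
      (exp ((b - a) * of_real (logit x)) - exp ((b - a) * of_real (logit t))) / (b - a)"
    using ab x t True
    by (intro has_bochner_integral_integral_eq has_bochner_integral_exp_logit_between) auto
  also have "?K * \<dots> = (?K * exp ((b - a) * of_real (logit x)) - ?K * exp ((b - a) * of_real (logit t))) / (b - a)"
    by (simp add: right_diff_distrib)
  also have "\<dots> = (power_kernel b x t - power_kernel a x t) / (b - a)"
    unfolding power_kernel_collapse ..
  finally show ?thesis using True by (simp add: lower_kernel_def)
next
  case False
  then have "lower_kernel a x y * lower_kernel b y t = 0" for y
    by (auto simp: lower_kernel_def)
  then have "(LINT y|M01. lower_kernel a x y * lower_kernel b y t) = 0"
    by (simp only: Bochner_Integration.integral_zero)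
  then show ?thesis using False by (simp add: lower_kernel_def)
qed

text \<open>The intermediate variable ranges over \<open>0 < y < min x t\<close>. The lower end contributes nothing because
\<open>Re (b - a) > 0\<close>, and the upper end gives one kernel or the other, according to which of \<open>x\<close> and
\<open>t\<close> is smaller.\<close>

lemma lower_upper_compose:
  assumes ab: "Re a < Re b" and x: "x \<in> {0<..<1}" and t: "t \<in> {0<..<1}"
  shows "(LINT y|M01. lower_kernel a x y * upper_kernel b y t) =
    (lower_kernel a x t + upper_kernel b x t) / (b - a)"
proof -
  let ?K = "exp (a * of_real (logit x) - b * of_real (logit t)) / of_real (x * (1 - t))"
  let ?h = "\<lambda>y. if y < min x t then exp ((b - a) * of_real (logit y)) / of_real (y * (1 - y)) else 0"
  note measurable_M01_id [measurable]
  have "(LINT y|M01. lower_kernel a x y * upper_kernel b y t) = (LINT y|M01. ?K * ?h y)"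
  proof (rule integral_cong_AE)
    have "AE y in M01. y \<in> {0<..<1}" by (intro AE_I2) simp
    with AE_M01_neq[of t]
    show "AE y in M01. lower_kernel a x y * upper_kernel b y t = ?K * ?h y"
      by eventually_elim (use x t in \<open>auto simp: lower_kernel_def upper_kernel_def power_kernel_mult
          simp del: of_real_mult of_real_diff\<close>)
    show "(\<lambda>y. lower_kernel a x y * upper_kernel b y t) \<in> borel_measurable M01"
      unfolding lower_kernel_def upper_kernel_def power_kernel_def by measurable
  qed measurable
  also have "\<dots> = ?K * (LINT y|M01. ?h y)"
    by (rule integral_mult_right_zero)
  also have "(LINT y|M01. ?h y) = exp ((b - a) * of_real (logit (min x t))) / (b - a)"
    using ab x t
    by (intro has_bochner_integral_integral_eq has_bochner_integral_exp_logit_below) auto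
  also have "?K * \<dots> = (?K * exp ((b - a) * of_real (logit (min x t)))) / (b - a)"
    by simp
  also have "?K * exp ((b - a) * of_real (logit (min x t))) =
      (if t < x then power_kernel a x t else power_kernel b x t)"
    using power_kernel_collapse[of a x b t] by (simp add: min_def)
  finally show ?thesis by (simp add: lower_kernel_def upper_kernel_def)
qed

lemma upper_lower_compose:
  assumes ab: "Re b < Re a" and x: "x \<in> {0<..<1}" and t: "t \<in> {0<..<1}"
  shows "(LINT y|M01. upper_kernel a x y * lower_kernel b y t) =
    (upper_kernel a x t + lower_kernel b x t) / (a - b)"
proof -
  let ?K = "exp (a * of_real (logit x) - b * of_real (logit t)) / of_real (x * (1 - t))"
  let ?h = "\<lambda>y. if max x t < y then exp ((b - a) * of_real (logit y)) / of_real (y * (1 - y)) else 0"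
  note measurable_M01_id [measurable]
  have "(LINT y|M01. upper_kernel a x y * lower_kernel b y t) = (LINT y|M01. ?K * ?h y)"
  proof (rule integral_cong_AE)
    have "AE y in M01. y \<in> {0<..<1}" by (intro AE_I2) simp
    with AE_M01_neq[of x]
    show "AE y in M01. upper_kernel a x y * lower_kernel b y t = ?K * ?h y"
      by eventually_elim (use x t in \<open>auto simp: lower_kernel_def upper_kernel_def power_kernel_mult
          simp del: of_real_mult of_real_diff\<close>)
    show "(\<lambda>y. upper_kernel a x y * lower_kernel b y t) \<in> borel_measurable M01"
      unfolding lower_kernel_def upper_kernel_def power_kernel_def by measurable
  qed measurable
  also have "\<dots> = ?K * (LINT y|M01. ?h y)"
    by (rule integral_mult_right_zero)
  also have "(LINT y|M01. ?h y) = - exp ((b - a) * of_real (logit (max x t))) / (b - a)"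
    using ab x t
    by (intro has_bochner_integral_integral_eq has_bochner_integral_exp_logit_above) auto
  also have "\<dots> = exp ((b - a) * of_real (logit (max x t))) / (a - b)"
    by (metis minus_diff_eq minus_divide_divide minus_minus)
  also have "?K * \<dots> = (?K * exp ((b - a) * of_real (logit (max x t)))) / (a - b)"
    by simp
  also have "?K * exp ((b - a) * of_real (logit (max x t))) =
      (if t < x then power_kernel b x t else power_kernel a x t)"
    using power_kernel_collapse[of a x b t] by (simp add: max_def)
  finally show ?thesis by (simp add: lower_kernel_def upper_kernel_def)
qed

section \<open>Complex scalars\<close>

lemma scaleC_simps:
  "c *\<^sub>C (F + G) = c *\<^sub>C F + c *\<^sub>C G"
  "c *\<^sub>C (F - G) = c *\<^sub>C F - c *\<^sub>C G"
  "c *\<^sub>C (d *\<^sub>C F) = (c * d) *\<^sub>C F"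
  "1 *\<^sub>C F = F"
  by (transfer; auto intro!: square_integrable_add square_integrable_diff square_integrable_cmult
      simp: algebra_simps)+

lemma scaleC_diff_left: "(c - d) *\<^sub>C F = c *\<^sub>C F - d *\<^sub>C F"
  by transfer (auto intro!: square_integrable_diff square_integrable_cmult simp: algebra_simps)

lemma norm_scaleC: "norm (c *\<^sub>C F) = cmod c * norm F"
  by transfer (simp add: norm_mult power_mult_distrib real_sqrt_mult)

text \<open>The type of bounded operators knows only real scalars, so complex multiples enter as operators.\<close>

lemma bounded_linear_scaleC: "bounded_linear ((*\<^sub>C) c)"
proof (rule bounded_linear_intro)
  show "norm (c *\<^sub>C F) \<le> norm F * cmod c" for F
    by (simp add: norm_scaleC mult.commute)
  show "c *\<^sub>C (r *\<^sub>R F) = r *\<^sub>R (c *\<^sub>C F)" for r F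
    by transfer (auto intro!: square_integrable_scaleR square_integrable_cmult)
qed (rule scaleC_simps)

section \<open>The resolvent\<close>

lemma cesaro_eq_kernel_operator: "cesaro = kernel_operator (lower_kernel 0)"
proof (rule blinfun_eqI)
  fix F
  obtain f where f: "square_integrable f" "F = abs_L2 f" by (cases F)
  have k: "schur_kernel (1 / (1 / 2 - Re 0)) (lower_kernel 0)"
    by (rule schur_kernel_lower) simp
  have "cesaro_fun f x = kernel_fun (lower_kernel 0) f x" if "x \<in> {0<..<1}" for x
    unfolding cesaro_fun_kernel[OF that] kernel_fun_def
    by (rule Bochner_Integration.integral_cong)
       (auto simp: cesaro_kernel_def lower_kernel_def power_kernel_def)
  then have "AE x in M01. cesaro_fun f x = kernel_fun (lower_kernel 0) f x"
    by (intro AE_I2) simp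
  then show "cesaro F = kernel_operator (lower_kernel 0) F"
    using f by (simp add: cesaro_abs_L2 kernel_operator_abs[OF k] abs_L2_eq_iff
        square_integrable_cesaro_fun square_integrable_kernel_fun(1)[OF k])
qed

lemma kernel_operator_compose:
  assumes k: "schur_kernel B k" and l: "schur_kernel B' l"
    and p: "schur_kernel B'' p" and q: "schur_kernel B''' q"
    and kl: "\<And>x t. x \<in> {0<..<1} \<Longrightarrow> t \<in> {0<..<1} \<Longrightarrow> (LINT y|M01. k x y * l y t) = c * (p x t - q x t)"
  shows "kernel_operator k (kernel_operator l F) = c *\<^sub>C (kernel_operator p F - kernel_operator q F)"
proof -
  obtain f where f: "square_integrable f" "F = abs_L2 f" by (cases F)
  note s = square_integrable_kernel_fun(1)
  have "AE x in M01. kernel_fun k (kernel_fun l f) x = kernel_fun (\<lambda>x t. c * (p x t - q x t)) f x"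
    by (rule kernel_fun_compose[OF k l f(1) kl])
  then have "AE x in M01. kernel_fun k (kernel_fun l f) x = c * (kernel_fun p f x - kernel_fun q f x)"
    using AE_integrable_kernel[OF p f(1)] AE_integrable_kernel[OF q f(1)]
  proof eventually_elim
    case (elim x)
    have "kernel_fun (\<lambda>x t. c * (p x t - q x t)) f x = (LINT t|M01. c * (p x t * f t - q x t * f t))"
      unfolding kernel_fun_def by (simp add: algebra_simps)
    also have "\<dots> = c * (LINT t|M01. p x t * f t - q x t * f t)"
      by (rule integral_mult_right_zero)
    also have "\<dots> = c * (kernel_fun p f x - kernel_fun q f x)"
      using elim by (simp add: kernel_fun_def)
    finally show ?case using elim(1) by simp
  qed
  then have "abs_L2 (kernel_fun k (kernel_fun l f)) = abs_L2 (\<lambda>x. c * (kernel_fun p f x - kernel_fun q f x))"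
    using f(1) by (subst abs_L2_eq_iff)
      (auto intro!: square_integrable_cmult square_integrable_diff s[OF k] s[OF l] s[OF p] s[OF q])
  then show ?thesis
    using f s[OF l f(1)] s[OF p f(1)] s[OF q f(1)]
    by (simp add: kernel_operator_abs[OF k] kernel_operator_abs[OF l] kernel_operator_abs[OF p]
        kernel_operator_abs[OF q] minus_L2.abs_eq scaleC.abs_eq square_integrable_diff)
qed

lemma schur_kernel_uminus: "schur_kernel B k \<Longrightarrow> schur_kernel B (\<lambda>x t. - k x t)"
  using borel_measurable_uminus[of "\<lambda>(x, t). k x t" "M01 \<Otimes>\<^sub>M M01"]
  by (simp add: schur_kernel_def case_prod_beta)

text \<open>If \<open>a T K = a K T = K - T\<close>, then \<open>a + a\<^sup>2 K\<close> inverts \<open>1 / a - T\<close>: this rearranges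
\<open>(1 / a - T) (a + a\<^sup>2 K) = 1 + a (K - T - a T K)\<close>.\<close>

lemma resolvent_setI:
  assumes T: "complex_linear T" and K: "complex_linear K" and a: "a \<noteq> 0"
    and KT: "\<And>F. a *\<^sub>C K (T F) = K F - T F" and TK: "\<And>F. a *\<^sub>C T (K F) = K F - T F"
  shows "1 / a \<in> resolvent_set T"
proof -
  define R where "R = (\<lambda>F. a *\<^sub>C F + a *\<^sub>C (a *\<^sub>C K F))"
  have bl: "bounded_linear R"
    unfolding R_def
    by (intro bounded_linear_add bounded_linear_scaleC bounded_linear_compose[OF bounded_linear_scaleC]
        blinfun.bounded_linear_right)
  have R: "Blinfun R F = a *\<^sub>C F + a *\<^sub>C (a *\<^sub>C K F)" for F
    by (subst bounded_linear_Blinfun_apply[OF bl]) (simp add: R_def)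
  have lin: "K (c *\<^sub>C F) = c *\<^sub>C K F" "T (c *\<^sub>C F) = c *\<^sub>C T F" for c F
    using T K by (simp_all add: complex_linear_def)
  have "complex_linear (Blinfun R)"
    unfolding complex_linear_def R by (simp add: lin scaleC_simps mult_ac)
  moreover have "Blinfun R ((1 / a) *\<^sub>C F - T F) = F" for F
  proof -
    have "Blinfun R ((1 / a) *\<^sub>C F - T F) =
        F - a *\<^sub>C T F + (a *\<^sub>C K F - a *\<^sub>C (a *\<^sub>C K (T F)))"
      using a by (simp add: R blinfun.diff_right lin scaleC_simps)
    then show ?thesis by (simp add: KT scaleC_simps)
  qed
  moreover have "(1 / a) *\<^sub>C Blinfun R F - T (Blinfun R F) = F" for F
  proof -
    have "(1 / a) *\<^sub>C Blinfun R F - T (Blinfun R F) =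
        F + a *\<^sub>C K F - (a *\<^sub>C T F + a *\<^sub>C (a *\<^sub>C T (K F)))"
      using a by (simp add: R blinfun.add_right lin scaleC_simps)
    then show ?thesis by (simp add: TK scaleC_simps)
  qed
  ultimately show ?thesis
    unfolding resolvent_set_def by blast
qed

text \<open>By the composition formulas with one parameter \<open>0\<close>, both the lower kernel and the negative of the
upper kernel with parameter \<open>a\<close> satisfy the equations of the preceding lemma. They solve
\<open>h / a - C h = f\<close> by integrating from the left or from the right end point, and \<open>Re a\<close> decides which
of the two is bounded.\<close>

lemma resolvent_set_cesaro:
  assumes a: "a \<noteq> 0" "Re a \<noteq> 1 / 2"
  shows "1 / a \<in> resolvent_set cesaro"
proof -
  have 0: "schur_kernel (1 / (1 / 2 - Re 0)) (lower_kernel 0)"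
    by (rule schur_kernel_lower) simp
  obtain B l where l: "schur_kernel B l"
    and lk: "\<And>x t. x \<in> {0<..<1} \<Longrightarrow> t \<in> {0<..<1} \<Longrightarrow>
      (LINT y|M01. l x y * lower_kernel 0 y t) = (1 / a) * (l x t - lower_kernel 0 x t)"
    and kl: "\<And>x t. x \<in> {0<..<1} \<Longrightarrow> t \<in> {0<..<1} \<Longrightarrow>
      (LINT y|M01. lower_kernel 0 x y * l y t) = (1 / a) * (l x t - lower_kernel 0 x t)"
  proof (cases "Re a < 1 / 2")
    case True
    show ?thesis
    proof (rule that[OF schur_kernel_lower[OF True]])
      fix x t :: real assume xt: "x \<in> {0<..<1}" "t \<in> {0<..<1}"
      show "(LINT y|M01. lower_kernel a x y * lower_kernel 0 y t) =
          (1 / a) * (lower_kernel a x t - lower_kernel 0 x t)"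
        using lower_lower_compose[OF a(1) xt] a by (simp add: field_simps)
      show "(LINT y|M01. lower_kernel 0 x y * lower_kernel a y t) =
          (1 / a) * (lower_kernel a x t - lower_kernel 0 x t)"
        using lower_lower_compose[OF a(1)[symmetric] xt] by simp
    qed
  next
    case False
    then have r: "1 / 2 < Re a" "Re 0 < Re a" using a by auto
    show ?thesis
    proof (rule that[OF schur_kernel_uminus[OF schur_kernel_upper[OF r(1)]]])
      fix x t :: real assume xt: "x \<in> {0<..<1}" "t \<in> {0<..<1}"
      show "(LINT y|M01. - upper_kernel a x y * lower_kernel 0 y t) =
          (1 / a) * (- upper_kernel a x t - lower_kernel 0 x t)"
        using upper_lower_compose[OF r(2) xt] a by (simp add: field_simps)
      show "(LINT y|M01. lower_kernel 0 x y * - upper_kernel a y t) =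
          (1 / a) * (- upper_kernel a x t - lower_kernel 0 x t)"
        using lower_upper_compose[OF r(2) xt] a by (simp add: field_simps)
    qed
  qed
  show ?thesis
  proof (rule resolvent_setI[OF complex_linear_cesaro complex_linear_kernel_operator[OF l] a(1)])
    fix F
    have "kernel_operator l (cesaro F) = (1 / a) *\<^sub>C (kernel_operator l F - cesaro F)"
      unfolding cesaro_eq_kernel_operator by (rule kernel_operator_compose[OF l 0 l 0 lk])
    then show "a *\<^sub>C kernel_operator l (cesaro F) = kernel_operator l F - cesaro F"
      using a by (simp only: scaleC_simps(3)) (simp add: scaleC_simps(4))
    have "cesaro (kernel_operator l F) = (1 / a) *\<^sub>C (kernel_operator l F - cesaro F)"
      unfolding cesaro_eq_kernel_operator by (rule kernel_operator_compose[OF 0 l l 0 kl])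
    then show "a *\<^sub>C cesaro (kernel_operator l F) = kernel_operator l F - cesaro F"
      using a by (simp only: scaleC_simps(3)) (simp add: scaleC_simps(4))
  qed
qed

text \<open>Inversion \<open>z \<mapsto> 1 / z\<close> maps the circle \<open>|z - 1| = 1\<close> without \<open>0\<close> onto the line \<open>Re a = 1 / 2\<close>.\<close>

lemma spectrum_cesaro_subset: "spectrum cesaro \<subseteq> {z. cmod (z - 1) = 1}"
proof (rule subsetI, rule ccontr)
  fix z assume z: "z \<in> spectrum cesaro" "z \<notin> {z. cmod (z - 1) = 1}"
  then have nz: "z \<noteq> 0" by auto
  have "Re (1 / z) \<noteq> 1 / 2"
  proof
    assume "Re (1 / z) = 1 / 2"
    then have "2 * Re z = (Re z)\<^sup>2 + (Im z)\<^sup>2"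
      using nz by (simp add: Re_divide complex_neq_0 divide_simps split: if_splits)
    then have "(cmod (z - 1))\<^sup>2 = 1"
      unfolding cmod_power2 by (simp add: power2_eq_square algebra_simps)
    then show False using z(2) by (simp add: power2_eq_1_iff) (smt (verit) norm_ge_zero)
  qed
  then have "1 / (1 / z) \<in> resolvent_set cesaro"
    using nz by (intro resolvent_set_cesaro) auto
  with z(1) show False by (simp add: spectrum_def)
qed

section \<open>Approximate eigenvectors\<close>

text \<open>Without the truncation, \<open>exp (p * logit x) / x\<close> would satisfy \<open>C f = f / p\<close>, but it is never square
integrable: at \<open>x = 0\<close> this requires \<open>Re p > 1 / 2\<close>, at \<open>x = 1\<close> it requires \<open>Re p < 1 / 2\<close>. The cut
keeps the part near \<open>0\<close>; the cut point is where the logit vanishes.\<close>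

definition truncated_power :: "complex \<Rightarrow> real \<Rightarrow> complex" where
  "truncated_power p x = (if x < 1 / 2 then exp (p * of_real (logit x)) / of_real x else 0)"

lemma truncated_power:
  assumes p: "1 / 2 < Re p"
  shows "square_integrable (truncated_power p)"
    and "(LINT x|M01. (cmod (truncated_power p x))\<^sup>2) = 1 / (2 * Re p - 1)"
proof -
  note measurable_M01_id [measurable]
  let ?r = "2 * Re p - 1"
  have r: "0 < ?r" using p by simp
  have m: "truncated_power p \<in> borel_measurable M01"
    unfolding truncated_power_def [abs_def] by measurable
  have h: "logit (1 / 2) = 0" by (simp add: logit_def)
  have "(\<integral>\<^sup>+x. ennreal ((cmod (truncated_power p x))\<^sup>2) \<partial>M01) =
      (\<integral>\<^sup>+x. ennreal (if x < 1 / 2 then exp (?r * logit x) / (x * (1 - x)) else 0) \<partial>M01)"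
  proof (intro nn_integral_cong arg_cong[where f = ennreal])
    fix x assume "x \<in> space M01"
    then have x: "x \<in> {0<..<1}" by simp
    have "(exp (Re p * logit x) / x)\<^sup>2 = exp (?r * logit x) * exp (logit x) / x\<^sup>2"
      by (simp add: power_divide power2_eq_square algebra_simps flip: exp_add)
    also have "\<dots> = exp (?r * logit x) / (x * (1 - x))"
      unfolding exp_logit[OF x] using x by (simp add: power2_eq_square)
    finally show "(cmod (truncated_power p x))\<^sup>2 =
        (if x < 1 / 2 then exp (?r * logit x) / (x * (1 - x)) else 0)"
      using x by (simp add: truncated_power_def norm_divide cmod_exp_logit)
  qed
  also have "\<dots> = ennreal (1 / ?r)"
    using nn_integral_exp_logit_below[OF r, of "1 / 2"] by (simp add: h)
  finally have *: "(\<integral>\<^sup>+x. ennreal ((cmod (truncated_power p x))\<^sup>2) \<partial>M01) = ennreal (1 / ?r)" .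
  show "square_integrable (truncated_power p)"
    using * m by (simp add: square_integrable_iff_nn ennreal_power)
  show "(LINT x|M01. (cmod (truncated_power p x))\<^sup>2) = 1 / ?r"
    using * m r by (intro integral_eq_nn_integral[THEN trans]) auto
qed

text \<open>Left of the cut the eigenvalue equation persists, since \<open>C\<close> only looks to the left of \<open>x\<close>; to the
right the integral no longer grows and leaves the error term \<open>1 / (p x)\<close>.\<close>

lemma cesaro_fun_truncated_power:
  assumes p: "1 / 2 < Re p" and x: "x \<in> {0<..<1}"
  shows "cesaro_fun (truncated_power p) x =
    (1 / p) * truncated_power p x + (if x < 1 / 2 then 0 else 1 / (p * of_real x))"
proof -
  let ?h = "\<lambda>t. if t < min x (1 / 2) then exp (p * of_real (logit t)) / of_real (t * (1 - t)) else 0"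
  have h: "logit (1 / 2) = 0" by (simp add: logit_def)
  have "cesaro_fun (truncated_power p) x = (LINT t|M01. 1 / of_real x * ?h t)"
    unfolding cesaro_fun_kernel[OF x]
    by (intro Bochner_Integration.integral_cong)
       (auto simp: cesaro_kernel_def truncated_power_def)
  also have "\<dots> = 1 / of_real x * (LINT t|M01. ?h t)"
    by (rule integral_mult_right_zero)
  also have "(LINT t|M01. ?h t) = exp (p * of_real (logit (min x (1 / 2)))) / p"
    using p x
    by (intro has_bochner_integral_integral_eq has_bochner_integral_exp_logit_below) auto
  finally show ?thesis
    using h by (cases "x < 1 / 2")
      (simp_all add: truncated_power_def[of p x] min_absorb1 min_absorb2)
qed

lemma nn_integral_inverse_square: "(\<integral>\<^sup>+x. ennreal (if x < 1 / 2 then 0 else 1 / x\<^sup>2) \<partial>M01) = 1"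
proof -
  have "((\<lambda>x. 1 / x\<^sup>2) has_integral (- 1 / 1 - (- 1 / (1 / 2)))) {1 / 2..1::real}"
    by (rule fundamental_theorem_of_calculus)
       (auto intro!: derivative_eq_intros simp: divide_simps power2_eq_square
         simp flip: has_real_derivative_iff_has_vector_derivative)
  then have "(\<integral>\<^sup>+x. ennreal (indicator {1 / 2..1} x * (1 / x\<^sup>2)) \<partial>lborel) = ennreal 1"
    by (intro nn_integral_has_integral_lebesgue) auto
  moreover have "AE x in lborel. ennreal (if x < 1 / 2 then 0 else 1 / x\<^sup>2) * indicator {0<..<1} x =
      ennreal (indicator {1 / 2..1} x * (1 / x\<^sup>2))"
    using AE_lborel_singleton[of "1::real"] by eventually_elim (auto simp: indicator_def)
  ultimately show ?thesis
    unfolding nn_integral_M01 by (subst nn_integral_cong_AE) auto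
qed

text \<open>With \<open>p = 1 / w\<close>, the truncated power has norm \<open>1 / sqrt (2 Re p - 1)\<close> and the error has norm
\<open>1 / |p|\<close>. Their quotient is \<open>sqrt (2 Re w - |w|\<^sup>2) = sqrt (1 - |w - 1|\<^sup>2)\<close>, which tends to \<open>0\<close> as
\<open>w\<close> approaches the circle from inside.\<close>

lemma approximate_eigenvector:
  assumes w: "cmod (w - 1) < 1"
  obtains F where "norm F \<noteq> 0" "norm (w *\<^sub>C F - cesaro F) = sqrt (1 - (cmod (w - 1))\<^sup>2) * norm F"
proof -
  have w0: "w \<noteq> 0" using w by auto
  define p where "p = 1 / w"
  have d: "1 - (cmod (w - 1))\<^sup>2 = 2 * Re w - (cmod w)\<^sup>2"
    unfolding cmod_power2 by (simp add: power2_eq_square algebra_simps)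
  have e: "(2 * Re p - 1) * (cmod w)\<^sup>2 = 1 - (cmod (w - 1))\<^sup>2"
  proof -
    have "Re p = Re w / (cmod w)\<^sup>2"
      by (simp add: p_def Re_divide cmod_power2)
    then show ?thesis unfolding d using w0 by (simp add: field_simps)
  qed
  have "(cmod (w - 1))\<^sup>2 < 1" using w by (simp add: power_less_one_iff abs_square_less_1)
  with e w0 have p: "1 / 2 < Re p"
    by (smt (verit) mult_nonpos_nonneg zero_le_power2 field_sum_of_halves)
  let ?f = "truncated_power p"
  define g where "g x = (if x < 1 / 2 then 0 else - (w / of_real x))" for x :: real
  note measurable_M01_id [measurable]
  have [measurable]: "g \<in> borel_measurable M01" unfolding g_def [abs_def] by measurable
  have f: "square_integrable ?f" by (rule truncated_power(1)[OF p])
  have "(\<integral>\<^sup>+x. ennreal ((cmod (g x))\<^sup>2) \<partial>M01) =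
      (\<integral>\<^sup>+x. ennreal ((cmod w)\<^sup>2) * ennreal (if x < 1 / 2 then 0 else 1 / x\<^sup>2) \<partial>M01)"
    by (intro nn_integral_cong)
       (simp add: g_def norm_divide power_divide ennreal_mult'[symmetric])
  also have "\<dots> = ennreal ((cmod w)\<^sup>2)"
    using nn_integral_inverse_square by (subst nn_integral_cmult) simp_all
  finally have g2: "(\<integral>\<^sup>+x. ennreal ((cmod (g x))\<^sup>2) \<partial>M01) = ennreal ((cmod w)\<^sup>2)" .
  have g: "square_integrable g"
    using g2 by (simp add: square_integrable_iff_nn ennreal_power)
  have ng: "norm (abs_L2 g) = cmod w"
    using g2 by (simp add: norm_abs_L2[OF g] integral_eq_nn_integral)
  have "AE x in M01. w * ?f x - cesaro_fun ?f x = g x"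
  proof (rule AE_I2)
    fix x assume "x \<in> space M01"
    then have x: "x \<in> {0<..<1}" by simp
    show "w * ?f x - cesaro_fun ?f x = g x"
      unfolding cesaro_fun_truncated_power[OF p x] by (simp add: p_def g_def)
  qed
  then have "abs_L2 (\<lambda>x. w * ?f x - cesaro_fun ?f x) = abs_L2 g"
    using f g by (subst abs_L2_eq_iff)
      (auto intro!: square_integrable_diff square_integrable_cmult square_integrable_cesaro_fun)
  then have "w *\<^sub>C abs_L2 ?f - cesaro (abs_L2 ?f) = abs_L2 g"
    using f by (simp add: cesaro_abs_L2 scaleC.abs_eq minus_L2.abs_eq square_integrable_cmult
        square_integrable_cesaro_fun)
  moreover have nf: "norm (abs_L2 ?f) = 1 / sqrt (2 * Re p - 1)"
    by (simp add: norm_abs_L2[OF f] truncated_power(2)[OF p] real_sqrt_divide)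
  moreover have "sqrt (1 - (cmod (w - 1))\<^sup>2) * (1 / sqrt (2 * Re p - 1)) = cmod w"
    unfolding e[symmetric] using p by (simp add: real_sqrt_mult)
  ultimately show ?thesis
    using p by (intro that[of "abs_L2 ?f"]) (simp_all add: ng)
qed

text \<open>Approach \<open>z\<close> along the radius, \<open>w = 1 + r (z - 1)\<close> with \<open>r < 1\<close>. This treats \<open>z = 0\<close> like every
other point of the circle, although \<open>1 / z\<close> has no meaning there.\<close>

lemma approximate_eigenvalue:
  assumes z: "cmod (z - 1) = 1" and e: "0 < e"
  obtains F where "norm F \<noteq> 0" "norm (z *\<^sub>C F - cesaro F) < e * norm F"
proof -
  \<comment> \<open>Here \<open>1 - r\<close> is the distance from \<open>z\<close> to \<open>w\<close>, the root is the relative error at \<open>w\<close>\<close>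
  have "((\<lambda>r. (1 - r) + sqrt (1 - r\<^sup>2)) \<longlongrightarrow> (1 - 1) + sqrt (1 - 1\<^sup>2)) (at_left (1::real))"
    by (intro tendsto_intros)
  then have "\<forall>\<^sub>F r in at_left (1::real). (1 - r) + sqrt (1 - r\<^sup>2) < e"
    using e by (intro order_tendstoD(2)) auto
  moreover have "\<forall>\<^sub>F r in at_left (1::real). r \<in> {0<..<1}"
    by (rule eventually_at_left_real) simp
  ultimately obtain r :: real where r: "(1 - r) + sqrt (1 - r\<^sup>2) < e" "0 < r" "r < 1"
    using eventually_happens[OF eventually_conj] by force
  define w where "w = 1 + of_real r * (z - 1)"
  have w: "cmod (w - 1) = r" using r z by (simp add: w_def norm_mult)
  have "z - w = of_real (1 - r) * (z - 1)" by (simp add: w_def algebra_simps)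
  then have zw: "cmod (z - w) = 1 - r" using r z by (simp only: norm_mult norm_of_real) simp
  obtain F where F: "norm F \<noteq> 0" "norm (w *\<^sub>C F - cesaro F) = sqrt (1 - (cmod (w - 1))\<^sup>2) * norm F"
    using approximate_eigenvector[of w] w r(3) by auto
  have "z *\<^sub>C F - cesaro F = (z - w) *\<^sub>C F + (w *\<^sub>C F - cesaro F)"
    by (simp add: scaleC_diff_left)
  then have "norm (z *\<^sub>C F - cesaro F) \<le> norm ((z - w) *\<^sub>C F) + norm (w *\<^sub>C F - cesaro F)"
    by (metis norm_triangle_ineq)
  also have "\<dots> = ((1 - r) + sqrt (1 - r\<^sup>2)) * norm F"
    unfolding F(2) norm_scaleC zw w by (simp add: distrib_right)
  also have "\<dots> < e * norm F"
    using r(1) F(1) by (intro mult_strict_right_mono) auto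
  finally show ?thesis using F(1) by (intro that)
qed

text \<open>A bounded inverse \<open>S\<close> of \<open>z - C\<close> would force \<open>norm F \<le> norm S * norm (z F - C F)\<close> for all \<open>F\<close>.\<close>

lemma circle_subset_spectrum_cesaro: "{z. cmod (z - 1) = 1} \<subseteq> spectrum cesaro"
proof (rule subsetI, rule ccontr)
  fix z assume z: "z \<in> {z. cmod (z - 1) = 1}" and "z \<notin> spectrum cesaro"
  then obtain S :: "L2 \<Rightarrow>\<^sub>L L2" where S: "\<And>F. S (z *\<^sub>C F - cesaro F) = F"
    by (auto simp: spectrum_def resolvent_set_def)
  \<comment> \<open>Adding \<open>1\<close> keeps the quotient meaningful when \<open>S\<close> vanishes.\<close>
  have e: "0 < 1 / (norm S + 1)"
    by (simp add: add_nonneg_pos)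
  obtain F where F: "norm F \<noteq> 0" "norm (z *\<^sub>C F - cesaro F) < 1 / (norm S + 1) * norm F"
    using approximate_eigenvalue[OF _ e] z by blast
  have "norm F \<le> norm S * norm (z *\<^sub>C F - cesaro F)"
    using norm_blinfun[of S "z *\<^sub>C F - cesaro F"] by (simp add: S)
  also have "\<dots> \<le> (norm S + 1) * norm (z *\<^sub>C F - cesaro F)"
    by (intro mult_right_mono) auto
  also have "\<dots> < (norm S + 1) * (1 / (norm S + 1) * norm F)"
    using F(2) by (intro mult_strict_left_mono) (auto simp: add_nonneg_pos)
  also have "\<dots> = norm F"
    using e by simp
  finally show False by simp
qed

text \<open>The upper bound is the Schur test for the Cesaro kernel; the lower bound holds because \<open>2\<close> lies on the
circle of approximate eigenvalues.\<close>

lemma norm_cesaro: "norm cesaro = 2"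
proof (rule antisym)
  show "norm cesaro \<le> 2"
  proof (rule norm_blinfun_bound)
    fix F
    obtain f where f: "square_integrable f" "F = abs_L2 f" by (cases F)
    have "sqrt (LINT x|M01. (cmod (cesaro_fun f x))\<^sup>2) \<le> sqrt (4 * (LINT x|M01. (cmod (f x))\<^sup>2))"
      by (intro real_sqrt_le_mono cesaro_fun_norm_bound f)
    then show "norm (cesaro F) \<le> 2 * norm F"
      using f by (simp add: cesaro_abs_L2 norm_abs_L2 square_integrable_cesaro_fun real_sqrt_mult)
  qed simp
  show "2 \<le> norm cesaro"
  proof (rule field_le_epsilon)
    fix e :: real assume e: "0 < e"
    obtain F where F: "norm F \<noteq> 0" "norm (2 *\<^sub>C F - cesaro F) < e * norm F"
      using approximate_eigenvalue[of 2, OF _ e] by auto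
    have "2 * norm F = norm ((2 *\<^sub>C F - cesaro F) + cesaro F)"
      by (simp add: norm_scaleC)
    also have "\<dots> \<le> norm (2 *\<^sub>C F - cesaro F) + norm (cesaro F)"
      by (rule norm_triangle_ineq)
    also have "\<dots> \<le> e * norm F + norm cesaro * norm F"
      using F(2) norm_blinfun[of cesaro F] by linarith
    finally have "2 * norm F \<le> (norm cesaro + e) * norm F"
      by (simp add: algebra_simps)
    then show "2 \<le> norm cesaro + e"
      using F(1) by simp
  qed
qed

theorem theorem2p11:
  shows "norm cesaro = 2 \<and>
    spectrum cesaro = frontier (ball 1 1) \<and>
    frontier (ball 1 1) = {z :: complex. cmod (z - 1) = 1}"
proof -
  have "frontier (ball 1 1) = {z :: complex. cmod (z - 1) = 1}"
    by (auto simp: frontier_ball dist_norm norm_minus_commute)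
  then show ?thesis
    using norm_cesaro spectrum_cesaro_subset circle_subset_spectrum_cesaro by auto
qed

end
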